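(* Let $S=K[t_1,\ldots,t_s]$ be a polynomial ring over a field $K$, let $I$ be a monomial ideal of $S$ and let $A$ be its incidence matrix. A monomial $t^\alpha\in S$ is a minimal generator of $\overline{I^n}$ if and only if the following two conditions hold: (1) $\max\{\langle y,1\rangle\mid y\geq 0;\, Ay\leq\alpha\}=\min\{\langle\alpha,x\rangle\mid x\geq 0;\, xA\geq 1\}\geq n$; (2) $\max\{\langle y,1\rangle\mid y\geq 0;\, Ay\leq\alpha-e_i\}=\min\{\langle\alpha-e_i,x\rangle\mid x\geq 0;\, xA\geq 1\}<n$ for each $e_i$ for which $\alpha-e_i\geq 0$.
   Context: $\mathbb{N}=\{0,1,2,\ldots\}$ and $n\geq 1$ is an integer. For $a=(a_1,\ldots,a_s)\in\mathbb{N}^s$, $t^a:=t_1^{a_1}\cdots t_s^{a_s}$. Let $\{t^{v_1},\ldots,t^{v_q}\}$ be the minimal set of monomial generators of $I$, with $v_i\in\mathbb{N}^s\setminus\{0\}$ for all $i$; the incidence matrix $A$ of $I$ is the $s\times q$ matrix with column vectors $v_1,\ldots,v_q$. $e_i$ is the $i$-th unit vector of $\mathbb{R}^s$, $1\leq i\leq s$. $\overline{I^n}$ is the integral closure of $I^n$ (a monomial ideal); "minimal generator" means a member of its minimal set of monomial generators. $\langle\ ,\,\rangle$ is the ordinary inner product; $1=(1,\ldots,1)$; inequalities between vectors are entrywise. The variable $y$ ranges over $\mathbb{R}^q$ (column vectors) and $x$ over $\mathbb{R}^s$ (row vectors). *)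

theory Defs
  imports "HOL-Analysis.Analysis" "HOL-Library.Poly_Mapping"
begin

text \<open>
  The polynomial ring \<open>K[t\<^sub>1, \<dots>, t\<^sub>s]\<close> is the monoid algebra of \<open>\<nat>\<^sup>s\<close> over \<open>'k\<close>, with the
  variables indexed by a finite type \<open>'s\<close>.
\<close>

type_synonym 's exponent = "'s \<Rightarrow>\<^sub>0 nat"
type_synonym ('s, 'k) polyring = "('s \<Rightarrow>\<^sub>0 nat) \<Rightarrow>\<^sub>0 'k"

definition monomial :: "'s exponent \<Rightarrow> ('s, 'k::field) polyring"
  where "monomial a = Poly_Mapping.single a 1"

text \<open>Ideals are the submodules of the ring regarded as a module over itself.\<close>

definition ideal_gen :: "'r::comm_ring_1 set \<Rightarrow> 'r set"
  where "ideal_gen G = module.span (*) G"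

primrec ideal_power :: "'r::comm_ring_1 set \<Rightarrow> nat \<Rightarrow> 'r set"
  where
    "ideal_power I 0 = UNIV"
  | "ideal_power I (Suc n) = ideal_gen {f * g | f g. f \<in> I \<and> g \<in> ideal_power I n}"

text \<open>
  \<open>f\<close> is integral over the ideal \<open>J\<close> if \<open>f\<^sup>k + a\<^sub>1 f\<^sup>k\<^sup>-\<^sup>1 + \<dots> + a\<^sub>k = 0\<close> for some \<open>k \<ge> 1\<close> and some
  \<open>a\<^sub>i \<in> J\<^sup>i\<close>.
\<close>

definition integral_closure :: "'r::comm_ring_1 set \<Rightarrow> 'r set"
  where "integral_closure J =
    {f. \<exists>k\<ge>1. \<exists>a. (\<forall>i\<in>{1..k}. a i \<in> ideal_power J i) \<and>
          f ^ k + (\<Sum>i\<in>{1..k}. a i * f ^ (k - i)) = 0}"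

definition monomial_ideal :: "('s, 'k::field) polyring set \<Rightarrow> bool"
  where "monomial_ideal I \<longleftrightarrow> (\<exists>G \<subseteq> range monomial. I = ideal_gen G)"

definition is_minimal_monomial_gens ::
    "('s, 'k::field) polyring set \<Rightarrow> ('s, 'k) polyring set \<Rightarrow> bool"
  where "is_minimal_monomial_gens J G \<longleftrightarrow>
    G \<subseteq> range monomial \<and> ideal_gen G = J \<and> (\<forall>H. H \<subset> G \<longrightarrow> ideal_gen H \<noteq> J)"

text \<open>A monomial ideal has exactly one minimal set of monomial generators; the description
  is meaningful only for monomial ideals.\<close>

definition minimal_gens :: "('s, 'k::field) polyring set \<Rightarrow> ('s, 'k) polyring set"
  where "minimal_gens J = (THE G. is_minimal_monomial_gens J G)"

definition real_vec :: "('s::finite) exponent \<Rightarrow> real ^ 's"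
  where "real_vec a = (\<chi> i. real (Poly_Mapping.lookup a i))"

text \<open>
  An \<open>s \<times> q\<close> matrix is given by its columns \<open>A 1, \<dots>, A q\<close>, and a vector \<open>y \<in> \<real>\<^sup>q\<close> by its entries
  \<open>y 1, \<dots>, y q\<close> (other values are irrelevant), so that \<open>q = 0\<close>, i.e. the zero ideal, is allowed.
  Then \<open>A y = (\<Sum>j. y j *\<^sub>R A j)\<close> and the \<open>j\<close>-th entry of \<open>x A\<close> is \<open>x \<bullet> A j\<close>.
  The order on \<^typ>\<open>real ^ 's\<close> is entrywise.
\<close>

definition incidence_matrix :: "(nat \<Rightarrow> ('s::finite) exponent) \<Rightarrow> nat \<Rightarrow> real ^ 's"
  where "incidence_matrix v = (\<lambda>j. real_vec (v j))"

definition primal_values :: "nat \<Rightarrow> (nat \<Rightarrow> real ^ 's) \<Rightarrow> real ^ ('s::finite) \<Rightarrow> real set"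
  where "primal_values q A b =
    {(\<Sum>j\<in>{1..q}. y j * 1) | y.
        (\<forall>j\<in>{1..q}. 0 \<le> y j) \<and> (\<Sum>j\<in>{1..q}. y j *\<^sub>R A j) \<le> b}"

definition dual_values :: "nat \<Rightarrow> (nat \<Rightarrow> real ^ 's) \<Rightarrow> real ^ ('s::finite) \<Rightarrow> real set"
  where "dual_values q A b =
    {b \<bullet> x | x. 0 \<le> x \<and> (\<forall>j\<in>{1..q}. 1 \<le> x \<bullet> A j)}"

text \<open>Attained extrema of possibly infinite sets of reals (\<^const>\<open>Max\<close> and \<^const>\<open>Min\<close> are
  only for finite sets).\<close>

definition is_max :: "real \<Rightarrow> real set \<Rightarrow> bool"
  where "is_max m X \<longleftrightarrow> m \<in> X \<and> (\<forall>z\<in>X. z \<le> m)"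

definition is_min :: "real \<Rightarrow> real set \<Rightarrow> bool"
  where "is_min m X \<longleftrightarrow> m \<in> X \<and> (\<forall>z\<in>X. m \<le> z)"

end

theory Submission
  imports Defs
begin

text \<open>
  Write \<open>N c\<close> for the set of exponents \<open>a\<close> with \<open>A y \<le> a\<close> for some \<open>y \<ge> 0\<close> of coordinate sum at least
  \<open>c\<close>; for \<open>c > 0\<close> these are the lattice points of the \<open>c\<close>-fold dilation of the Newton polyhedron of
  \<open>I\<close>. The heart of the proof is that the integral closure of \<open>I\<^sup>n\<close> is spanned by the monomials with
  exponent in \<open>N n\<close> (\<open>integral_closure_power_monomial_ideal\<close>). In particular it is a monomial ideal,
  so its minimal generators are the monomials of the minimal elements of \<open>N n\<close>. Since \<open>N n\<close> is closed
  under adding exponents, \<open>\<alpha>\<close> is minimal in it iff \<open>\<alpha>\<close> belongs to it and no \<open>\<alpha> - e\<^sub>i\<close> does. By the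
  very definition of \<open>N n\<close>, membership says that the maximum of the primal linear program is at least
  \<open>n\<close>, and strong duality identifies the maximum with the minimum of the dual program.

  An integral element has all its exponents in \<open>N n\<close> because of weights. If \<open>a\<close> is not in \<open>N n\<close>, an
  optimal dual solution \<open>x\<close> defines an additive weight \<open>b \<mapsto> \<langle>x, b\<rangle>\<close> that is at least \<open>n\<close> on every
  exponent of \<open>I\<^sup>n\<close> but smaller than \<open>n\<close> at \<open>a\<close>. In an integral equation for a polynomial \<open>f\<close> that
  involves \<open>t\<^sup>a\<close>, every term other than \<open>f\<^sup>k\<close> then has weight strictly above \<open>k\<close> times the least weight
  of \<open>f\<close>, so the lowest part of \<open>f\<^sup>k\<close> could not cancel (\<open>weight_of_integral_element\<close>).

  Conversely, let all exponents of \<open>f\<close> lie in \<open>N n\<close>, let \<open>q\<close> be the number of generators of \<open>I\<close> and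
  \<open>M\<close> the span of the monomials with exponent in \<open>N q\<close>. For \<open>a\<close> in \<open>N n\<close> and \<open>b\<close> in \<open>N q\<close>, the sum
  \<open>a + b\<close> is in \<open>N (n + q)\<close>. As long as the coordinates of \<open>y\<close> sum to at least \<open>q\<close>, one of them is at
  least \<open>1\<close> and the corresponding generator can be split off; doing this \<open>n\<close> times gives
  \<open>f M \<subseteq> I\<^sup>n M\<close> (\<open>newton_exponents_split_power\<close>). As \<open>M\<close> is finitely generated, eliminating the
  generators one after the other from the resulting linear system produces an integral equation for
  \<open>f\<close> (\<open>integral_equation_annihilates\<close>).
\<close>

section \<open>Linear programming duality\<close>

lemma closed_finitely_generated_cone:
  fixes g :: "'i \<Rightarrow> 'a::euclidean_space"
  assumes "finite T"
  shows "closed {\<Sum>i\<in>T. c i *\<^sub>R g i | c. \<forall>i\<in>T. 0 \<le> c i}" (is "closed ?K")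
    and "convex_cone {\<Sum>i\<in>T. c i *\<^sub>R g i | c. \<forall>i\<in>T. 0 \<le> c i}"
proof -
  show cone: "convex_cone ?K"
    unfolding convex_cone_iff
  proof (intro conjI ballI allI impI)
    show "0 \<in> ?K"
      by (auto intro!: exI[of _ "\<lambda>_. 0"])
    fix x y assume "x \<in> ?K" "y \<in> ?K"
    then obtain c d where "x = (\<Sum>i\<in>T. c i *\<^sub>R g i)" "y = (\<Sum>i\<in>T. d i *\<^sub>R g i)"
      "\<forall>i\<in>T. 0 \<le> c i" "\<forall>i\<in>T. 0 \<le> d i" by blast
    then show "x + y \<in> ?K"
      by (auto intro!: exI[of _ "\<lambda>i. c i + d i"] simp: scaleR_add_left sum.distrib)
  next
    fix x and r :: real assume "x \<in> ?K" "0 \<le> r"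
    then obtain c where "x = (\<Sum>i\<in>T. c i *\<^sub>R g i)" "\<forall>i\<in>T. 0 \<le> c i" by blast
    with \<open>0 \<le> r\<close> show "r *\<^sub>R x \<in> ?K"
      by (auto intro!: exI[of _ "\<lambda>i. r * c i"] simp: scaleR_sum_right)
  qed
  have "?K = convex_cone hull (g ` T)"
  proof
    have "(\<Sum>i\<in>T. c i *\<^sub>R g i) \<in> convex_cone hull (g ` T)" if "\<forall>i\<in>T. 0 \<le> c i" for c
      using \<open>finite T\<close> that
    proof (induction T)
      case empty
      then show ?case by (simp add: convex_cone_hull_contains_0)
    next
      case (insert j T)
      then have "(\<Sum>i\<in>T. c i *\<^sub>R g i) \<in> convex_cone hull (g ` insert j T)"
        using hull_mono[of "g ` T" "g ` insert j T" convex_cone] by auto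
      moreover have "c j *\<^sub>R g j \<in> convex_cone hull (g ` insert j T)"
        using insert.prems by (intro convex_cone_hull_mul hull_inc) auto
      ultimately show ?case
        using insert.hyps by (simp add: convex_cone_hull_add)
    qed
    then show "?K \<subseteq> convex_cone hull (g ` T)" by blast
    show "convex_cone hull (g ` T) \<subseteq> ?K"
    proof (rule hull_minimal)
      show "convex_cone ?K" by (rule cone)
      have "g j \<in> ?K" if "j \<in> T" for j
      proof -
        have "(\<Sum>i\<in>T. (if i = j then 1 else 0) *\<^sub>R g i) = g j"
          using that \<open>finite T\<close> by (simp add: if_distrib[of "\<lambda>r. r *\<^sub>R _"] cong: if_cong)
        then show ?thesis
          by (intro CollectI exI[of _ "\<lambda>i. if i = j then 1 else 0"]) auto
      qed
      then show "g ` T \<subseteq> ?K" by blast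
    qed
  qed
  then show "closed ?K"
    using closed_convex_cone_hull[of "g ` T"] \<open>finite T\<close> by simp
qed

lemma farkas:
  fixes g :: "'i \<Rightarrow> 'a::euclidean_space"
  assumes "finite T" and "\<nexists>c. (\<forall>i\<in>T. 0 \<le> c i) \<and> (\<Sum>i\<in>T. c i *\<^sub>R g i) = z"
  shows "\<exists>x. x \<bullet> z < 0 \<and> (\<forall>i\<in>T. 0 \<le> x \<bullet> g i)"
proof -
  let ?K = "{\<Sum>i\<in>T. c i *\<^sub>R g i | c. \<forall>i\<in>T. 0 \<le> c i}"
  note cone = closed_finitely_generated_cone[OF \<open>finite T\<close>, of g]
  have "z \<notin> ?K" using assms(2) by blast
  moreover have "convex ?K" using cone(2) by (simp add: convex_cone_def)
  ultimately obtain x r where r: "x \<bullet> z < r" "\<And>k. k \<in> ?K \<Longrightarrow> r < x \<bullet> k"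
    using separating_hyperplane_closed_point[of ?K z] cone(1) by blast
  have "r < 0"
    using r(2)[OF convex_cone_contains_0[OF cone(2)]] by simp
  have "0 \<le> x \<bullet> g j" if "j \<in> T" for j
  proof (rule ccontr)
    assume neg: "\<not> 0 \<le> x \<bullet> g j"
    \<comment> \<open>A generator on the negative side could be scaled until it crosses the hyperplane.\<close>
    define t where "t = r / (x \<bullet> g j)"
    have "t \<ge> 0" using neg \<open>r < 0\<close> by (simp add: t_def divide_nonpos_nonpos)
    have "(\<Sum>i\<in>T. (if i = j then t else 0) *\<^sub>R g i) = t *\<^sub>R g j"
      using that \<open>finite T\<close> by (simp add: if_distrib[of "\<lambda>r. r *\<^sub>R _"] cong: if_cong)
    then have "t *\<^sub>R g j \<in> ?K"
      using \<open>t \<ge> 0\<close> by (intro CollectI exI[of _ "\<lambda>i. if i = j then t else 0"]) auto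
    from r(2)[OF this] show False using neg by (simp add: t_def)
  qed
  with r(1) \<open>r < 0\<close> show ?thesis by (intro exI[of _ x]) auto
qed

lemma weak_duality:
  assumes "s \<in> primal_values q A b" and "t \<in> dual_values q A b"
  shows "s \<le> t"
proof -
  obtain y where y: "s = (\<Sum>j\<in>{1..q}. y j * 1)" "\<forall>j\<in>{1..q}. 0 \<le> y j"
      "(\<Sum>j\<in>{1..q}. y j *\<^sub>R A j) \<le> b"
    using assms(1) by (auto simp: primal_values_def)
  obtain x where x: "t = b \<bullet> x" "0 \<le> x" "\<forall>j\<in>{1..q}. 1 \<le> x \<bullet> A j"
    using assms(2) by (auto simp: dual_values_def)
  have "s \<le> (\<Sum>j\<in>{1..q}. y j * (x \<bullet> A j))"
    unfolding y(1) using x(3) y(2) by (intro sum_mono mult_left_mono) auto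
  also have "\<dots> = x \<bullet> (\<Sum>j\<in>{1..q}. y j *\<^sub>R A j)"
    by (simp add: inner_sum_right)
  also have "\<dots> \<le> x \<bullet> b"
    using x(2) y(3) by (auto simp: inner_vec_def less_eq_vec_def intro!: sum_mono mult_left_mono)
  finally show ?thesis by (simp add: x(1) inner_commute)
qed

lemma sum_axis_eq: "(\<Sum>i\<in>UNIV. z $ i *\<^sub>R axis i 1) = (z :: real ^ 's::finite)"
  by (simp add: vec_eq_iff axis_def if_distrib cong: if_cong)

text \<open>
  The attainable pairs (right-hand side, value) form the cone generated by the columns \<open>(A j, 1)\<close>
  and the slack directions \<open>(e\<^sub>i, 0)\<close>, and the primal values for \<open>b\<close> are the fibre over \<open>b\<close>. Finitely
  generated cones are closed, which is what makes the maximum attained.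
\<close>

lemma closed_primal_values:
  fixes A :: "nat \<Rightarrow> real ^ 's::finite"
  shows "closed (primal_values q A b)"
proof -
  define T where "T = {1..q} <+> (UNIV :: 's set)"
  define g :: "nat + 's \<Rightarrow> (real ^ 's) \<times> real"
    where "g = case_sum (\<lambda>j. (A j, 1)) (\<lambda>i. (axis i 1, 0))"
  let ?K = "{\<Sum>i\<in>T. c i *\<^sub>R g i | c. \<forall>i\<in>T. 0 \<le> c i}"
  have sum: "(\<Sum>i\<in>T. c i *\<^sub>R g i) =
      ((\<Sum>j\<in>{1..q}. c (Inl j) *\<^sub>R A j) + (\<Sum>i\<in>UNIV. c (Inr i) *\<^sub>R axis i 1), \<Sum>j\<in>{1..q}. c (Inl j))" for c
    by (simp add: T_def g_def sum.Plus prod_eq_iff fst_sum snd_sum)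
  have "primal_values q A b = (\<lambda>t. (b, t)) -` ?K"
  proof (intro set_eqI iffI)
    fix t assume "t \<in> primal_values q A b"
    then obtain y where y: "t = (\<Sum>j\<in>{1..q}. y j * 1)" "\<forall>j\<in>{1..q}. 0 \<le> y j"
      "(\<Sum>j\<in>{1..q}. y j *\<^sub>R A j) \<le> b" by (auto simp: primal_values_def)
    let ?z = "b - (\<Sum>j\<in>{1..q}. y j *\<^sub>R A j)"
    define c where "c = case_sum y (\<lambda>i. ?z $ i)"
    have "(\<Sum>i\<in>T. c i *\<^sub>R g i) = (b, t)"
      unfolding sum c_def sum.case sum_axis_eq using y(1) by simp
    moreover have "\<forall>i\<in>T. 0 \<le> c i"
      using y(2,3) by (auto simp: T_def c_def less_eq_vec_def)
    ultimately show "t \<in> (\<lambda>t. (b, t)) -` ?K" 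
      unfolding vimage_def by (intro CollectI exI[of _ c] conjI) simp_all
  next
    fix t assume "t \<in> (\<lambda>t. (b, t)) -` ?K"
    then obtain c where c: "(b, t) = (\<Sum>i\<in>T. c i *\<^sub>R g i)" "\<forall>i\<in>T. 0 \<le> c i" by blast
    have "0 \<le> (\<Sum>i\<in>UNIV. c (Inr i) *\<^sub>R (axis i 1 :: real ^ 's))"
      using c(2) by (auto simp: T_def less_eq_vec_def axis_def intro!: sum_nonneg)
    moreover have "b = (\<Sum>j\<in>{1..q}. c (Inl j) *\<^sub>R A j) + (\<Sum>i\<in>UNIV. c (Inr i) *\<^sub>R axis i 1)"
      and "t = (\<Sum>j\<in>{1..q}. c (Inl j))"
      using c(1) unfolding sum by simp_all
    moreover have "\<forall>j\<in>{1..q}. 0 \<le> c (Inl j)"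
      using c(2) by (auto simp: T_def)
    ultimately show "t \<in> primal_values q A b"
      unfolding primal_values_def by (intro CollectI exI[of _ "\<lambda>j. c (Inl j)"]) simp
  qed
  moreover have "closed ((\<lambda>t. (b, t)) -` ?K)"
    by (intro continuous_closed_vimage closed_finitely_generated_cone continuous_intros) (simp add: T_def)
  ultimately show ?thesis by simp
qed

lemma bdd_above_primal_values:
  fixes A :: "nat \<Rightarrow> real ^ 's::finite"
  assumes nonneg: "\<forall>j\<in>{1..q}. 0 \<le> A j" and nonzero: "\<forall>j\<in>{1..q}. A j \<noteq> 0"
  shows "bdd_above (primal_values q A b)"
proof -
  have "\<forall>j\<in>{1..q}. \<exists>i. 0 < A j $ i"
  proof
    fix j assume j: "j \<in> {1..q}"
    then obtain i where "A j $ i \<noteq> 0" using nonzero by (metis vec_eq_iff zero_index)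
    moreover have "0 \<le> A j $ i" using nonneg j by (auto simp: less_eq_vec_def)
    ultimately show "\<exists>i. 0 < A j $ i" by (auto intro!: exI[of _ i])
  qed
  then obtain p where p: "\<And>j. j \<in> {1..q} \<Longrightarrow> 0 < A j $ p j" by metis
  show ?thesis
  proof (rule bdd_aboveI)
    fix t assume "t \<in> primal_values q A b"
    then obtain y where y: "t = (\<Sum>j\<in>{1..q}. y j)" "\<forall>j\<in>{1..q}. 0 \<le> y j"
      "(\<Sum>j\<in>{1..q}. y j *\<^sub>R A j) \<le> b" by (auto simp: primal_values_def)
    have "y j \<le> b $ p j / A j $ p j" if j: "j \<in> {1..q}" for j
    proof -
      have "y j * A j $ p j \<le> (\<Sum>k\<in>{1..q}. y k * A k $ p j)"
        using j y(2) nonneg by (intro member_le_sum) (auto simp: less_eq_vec_def)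
      also have "\<dots> \<le> b $ p j" using y(3) by (auto simp: less_eq_vec_def)
      finally show ?thesis using p[OF j] by (simp add: field_simps)
    qed
    then show "t \<le> (\<Sum>j\<in>{1..q}. b $ p j / A j $ p j)"
      unfolding y(1) by (rule sum_mono)
  qed
qed

text \<open>
  Let \<open>m\<close> be the primal maximum. A dual solution of value at most \<open>m\<close> is a solution \<open>x\<close> of the linear
  system \<open>x \<bullet> A j \<ge> 1\<close>, \<open>x \<bullet> e\<^sub>i \<ge> 0\<close>, \<open>- x \<bullet> b \<ge> - m\<close>. Farkas' lemma, in one dimension more to account
  for the right-hand sides, provides it unless a nonnegative combination of the constraints is
  contradictory, and such a combination would yield a better primal solution.
\<close>

lemma strong_duality:
  fixes A :: "nat \<Rightarrow> real ^ 's::finite"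
  assumes nonneg: "\<forall>j\<in>{1..q}. 0 \<le> A j" and nonzero: "\<forall>j\<in>{1..q}. A j \<noteq> 0" and "0 \<le> b"
  shows "\<exists>m. is_max m (primal_values q A b) \<and> is_min m (dual_values q A b)"
proof -
  let ?P = "primal_values q A b"
  define m where "m = Sup ?P"
  note bdd = bdd_above_primal_values[OF nonneg nonzero, of b]
  have "0 \<in> ?P"
    using \<open>0 \<le> b\<close> by (auto simp: primal_values_def intro!: exI[of _ "\<lambda>_. 0"])
  then have m: "m \<in> ?P"
    unfolding m_def using closed_primal_values bdd by (intro closed_contains_Sup) auto
  have max: "t \<le> m" if "t \<in> ?P" for t
    unfolding m_def using that bdd by (rule cSup_upper)
  define T where "T = {1..q} <+> (UNIV :: 's option set)"
  define g :: "nat + 's option \<Rightarrow> (real ^ 's) \<times> real"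
    where "g = case_sum (\<lambda>j. (A j, 1)) (case_option (- b, - m) (\<lambda>i. (axis i 1, 0)))"
  have infeasible: "\<nexists>c. (\<forall>i\<in>T. 0 \<le> c i) \<and> (\<Sum>i\<in>T. c i *\<^sub>R g i) = (0, 1)"
  proof
    assume "\<exists>c. (\<forall>i\<in>T. 0 \<le> c i) \<and> (\<Sum>i\<in>T. c i *\<^sub>R g i) = (0, 1)"
    then obtain c where c: "\<forall>i\<in>T. 0 \<le> c i" and eq: "(\<Sum>i\<in>T. c i *\<^sub>R g i) = (0, 1)" by blast
    define y where "y j = c (Inl j)" for j
    define l where "l = c (Inr None)"
    define z where "z = (\<Sum>i\<in>UNIV. c (Inr (Some i)) *\<^sub>R (axis i 1 :: real ^ 's))"
    have y: "\<forall>j\<in>{1..q}. 0 \<le> y j" and "0 \<le> l" and z: "0 \<le> z"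
      using c by (auto simp: T_def y_def l_def z_def less_eq_vec_def axis_def intro!: sum_nonneg)
    have "(\<Sum>i\<in>T. c i *\<^sub>R g i) =
      ((\<Sum>j\<in>{1..q}. y j *\<^sub>R A j) + (z - l *\<^sub>R b), (\<Sum>j\<in>{1..q}. y j) - l * m)"
      by (simp add: T_def g_def sum.Plus UNIV_option_conv sum.reindex prod_eq_iff fst_sum snd_sum
          y_def l_def z_def)
    with eq have *: "(\<Sum>j\<in>{1..q}. y j *\<^sub>R A j) + z = l *\<^sub>R b" "(\<Sum>j\<in>{1..q}. y j) = 1 + l * m"
      by (auto simp: algebra_simps)
    \<comment> \<open>Now \<open>A y \<le> l b\<close> and \<open>\<Sum> y = 1 + l m\<close>, so combining \<open>y\<close> with an optimal \<open>y0\<close> gives the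
        feasible point \<open>(y0 + y) / (1 + l)\<close> of value \<open>m + 1 / (1 + l)\<close>, even when \<open>l = 0\<close>.\<close>
    obtain y0 where y0: "m = (\<Sum>j\<in>{1..q}. y0 j)" "\<forall>j\<in>{1..q}. 0 \<le> y0 j"
      "(\<Sum>j\<in>{1..q}. y0 j *\<^sub>R A j) \<le> b" using m by (auto simp: primal_values_def)
    define w where "w j = (y0 j + y j) / (1 + l)" for j
    have "(\<Sum>j\<in>{1..q}. (y0 j + y j) *\<^sub>R A j) \<le> (1 + l) *\<^sub>R b"
    proof -
      have "(\<Sum>j\<in>{1..q}. (y0 j + y j) *\<^sub>R A j) + z \<le> b + l *\<^sub>R b"
        using y0(3) *(1) by (simp add: scaleR_add_left sum.distrib add.assoc)
      moreover have "(\<Sum>j\<in>{1..q}. (y0 j + y j) *\<^sub>R A j) \<le> (\<Sum>j\<in>{1..q}. (y0 j + y j) *\<^sub>R A j) + z"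
        using z by simp
      ultimately show ?thesis
        unfolding scaleR_add_left[of 1 l b] scaleR_one by (rule order_trans[rotated])
    qed
    then have "(1 / (1 + l)) *\<^sub>R (\<Sum>j\<in>{1..q}. (y0 j + y j) *\<^sub>R A j) \<le> (1 / (1 + l)) *\<^sub>R ((1 + l) *\<^sub>R b)"
      using \<open>0 \<le> l\<close> by (intro scaleR_left_mono) auto
    then have "(\<Sum>j\<in>{1..q}. w j *\<^sub>R A j) \<le> b"
      using \<open>0 \<le> l\<close> by (simp add: w_def scaleR_sum_right divide_inverse mult.commute)
    then have "(\<Sum>j\<in>{1..q}. w j) \<in> ?P"
      using y y0(2) \<open>0 \<le> l\<close> by (auto simp: primal_values_def w_def intro!: exI[of _ w])
    from max[OF this] have "(\<Sum>j\<in>{1..q}. y0 j + y j) / (1 + l) \<le> m"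
      by (simp add: w_def sum_divide_distrib)
    then show False
      using *(2) y0(1) \<open>0 \<le> l\<close> by (simp add: sum.distrib field_simps)
  qed
  then obtain u where u: "u \<bullet> (0, 1) < 0" "\<And>i. i \<in> T \<Longrightarrow> 0 \<le> u \<bullet> g i"
  proof -
    have "finite T" by (simp add: T_def)
    from farkas[OF this infeasible] that show ?thesis by blast
  qed
  obtain x s where us: "u = (x, s)" by (cases u)
  have "s < 0" using u(1) us by simp
  have A: "- s \<le> x \<bullet> A j" if "j \<in> {1..q}" for j
    using u(2)[of "Inl j"] that us by (simp add: T_def g_def InlI)
  have pos: "0 \<le> x $ i" for i
    using u(2)[of "Inr (Some i)"] us by (simp add: T_def g_def InrI inner_axis)
  have b: "x \<bullet> b \<le> - s * m"
    using u(2)[of "Inr None"] us by (simp add: T_def g_def InrI)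
  define x' where "x' = (1 / - s) *\<^sub>R x"
  have x': "0 \<le> x'" "\<forall>j\<in>{1..q}. 1 \<le> x' \<bullet> A j" "b \<bullet> x' \<le> m"
    using \<open>s < 0\<close> A pos b
    by (auto simp: x'_def less_eq_vec_def field_simps inner_commute[of b] divide_nonneg_neg)
  then have mem: "b \<bullet> x' \<in> dual_values q A b" by (auto simp: dual_values_def)
  with weak_duality[OF m] x'(3) have "m \<in> dual_values q A b" by (metis order_antisym)
  then show ?thesis
    using m max weak_duality[OF m] by (auto simp: is_max_def is_min_def)
qed

section \<open>Monomial ideals\<close>

interpretation ring: module "(*) :: 'r::comm_ring_1 \<Rightarrow> 'r \<Rightarrow> 'r"
  by unfold_locales (simp_all add: algebra_simps)

\<comment> \<open>This rule reassociates products to the left and loops together with \<open>mult.assoc\<close>.\<close>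
declare ring.scale_scale [simp del]

lemma subspace_mult_right:
  "ring.subspace W \<Longrightarrow> x \<in> W \<Longrightarrow> x * c \<in> W" for x :: "'r::comm_ring_1"
  using ring.subspace_scale[of W x c] by (simp add: mult.commute)

definition up_closed :: "'s exponent set \<Rightarrow> bool"
  where "up_closed U \<longleftrightarrow> (\<forall>a\<in>U. \<forall>c. a + c \<in> U)"

definition monomial_span :: "'s exponent set \<Rightarrow> ('s, 'k::field) polyring set"
  where "monomial_span U = {f. Poly_Mapping.keys f \<subseteq> U}"

definition minimal_exponents :: "'s exponent set \<Rightarrow> 's exponent set"
  where "minimal_exponents U = {a \<in> U. \<forall>b c. b \<in> U \<longrightarrow> a = b + c \<longrightarrow> c = 0}"

lemma keys_monomial [simp]:
  "Poly_Mapping.keys (monomial a :: ('s, 'k::field) polyring) = {a}"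
  by (simp add: monomial_def)

lemma monomial_add: "monomial (a + b) = monomial a * monomial b"
  by (simp add: monomial_def mult_single)

lemma monomial_in_span [simp]: "monomial a \<in> monomial_span U \<longleftrightarrow> a \<in> U"
  by (simp add: monomial_span_def)

lemma monomial_eq_iff [simp]:
  "(monomial a :: ('s, 'k::field) polyring) = monomial b \<longleftrightarrow> a = b"
  by (metis keys_monomial singleton_inject)

lemma polynomial_expansion:
  fixes f :: "('s, 'k::field) polyring"
  shows "f = (\<Sum>a\<in>Poly_Mapping.keys f. Poly_Mapping.single 0 (Poly_Mapping.lookup f a) * monomial a)"
proof (rule poly_mapping_eqI)
  fix b
  have "(\<Sum>a\<in>Poly_Mapping.keys f. Poly_Mapping.lookup (Poly_Mapping.single a (Poly_Mapping.lookup f a)) b)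
      = (\<Sum>a\<in>Poly_Mapping.keys f. if a = b then Poly_Mapping.lookup f a else 0)"
    by (intro sum.cong) (auto simp: lookup_single when_def)
  also have "\<dots> = Poly_Mapping.lookup f b"
    by (simp add: in_keys_iff)
  finally show "Poly_Mapping.lookup f b = Poly_Mapping.lookup
      (\<Sum>a\<in>Poly_Mapping.keys f. Poly_Mapping.single 0 (Poly_Mapping.lookup f a) * monomial a) b"
    by (simp add: lookup_sum monomial_def mult_single)
qed

lemma subspace_monomial_span:
  assumes "up_closed U"
  shows "ring.subspace (monomial_span U :: ('s, 'k::field) polyring set)"
proof (rule ring.subspaceI)
  show "(0 :: ('s, 'k) polyring) \<in> monomial_span U" by (simp add: monomial_span_def)
  fix f g :: "('s, 'k) polyring"
  assume f: "f \<in> monomial_span U"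
  { assume "g \<in> monomial_span U"
    then show "f + g \<in> monomial_span U"
      using f keys_add[of f g] by (auto simp: monomial_span_def) }
  show "g * f \<in> monomial_span U"
    unfolding monomial_span_def
  proof (intro CollectI subsetI)
    fix a assume "a \<in> Poly_Mapping.keys (g * f)"
    then obtain b c where "a = b + c" "c \<in> Poly_Mapping.keys f"
      using keys_mult[of g f] by blast
    then show "a \<in> U"
      using f assms by (auto simp: monomial_span_def up_closed_def add.commute[of b])
  qed
qed

lemma monomial_span_subset_subspace:
  fixes W :: "('s, 'k::field) polyring set"
  assumes W: "ring.subspace W" and mem: "\<And>a. a \<in> U \<Longrightarrow> monomial a \<in> W"
  shows "monomial_span U \<subseteq> W"
proof
  fix f :: "('s, 'k) polyring" assume f: "f \<in> monomial_span U"
  have "(\<Sum>a\<in>Poly_Mapping.keys f. Poly_Mapping.single 0 (Poly_Mapping.lookup f a) * monomial a) \<in> W"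
    using f by (intro ring.subspace_sum ring.subspace_scale W mem) (auto simp: monomial_span_def)
  then show "f \<in> W" by (simp flip: polynomial_expansion)
qed

text \<open>
  Multiples of a generator reach every monomial on the right, and these monomials span the right-hand
  side. Conversely, the right-hand side is an ideal because its set of exponents is upward closed.
\<close>

lemma ideal_gen_monomials:
  "ideal_gen (monomial ` E) = (monomial_span {e + c | e c. e \<in> E} :: ('s, 'k::field) polyring set)"
  unfolding ideal_gen_def
proof (rule ring.span_subspace)
  show up: "ring.subspace (monomial_span {e + c | e c. e \<in> E} :: ('s, 'k) polyring set)"
    by (rule subspace_monomial_span) (auto simp: up_closed_def, metis add.assoc)
  show "monomial ` E \<subseteq> (monomial_span {e + c | e c. e \<in> E} :: ('s, 'k) polyring set)"
    by (auto, metis add.right_neutral)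
  show "monomial_span {e + c | e c. e \<in> E} \<subseteq> ring.span (monomial ` E :: ('s, 'k) polyring set)"
  proof (rule monomial_span_subset_subspace[OF ring.subspace_span], clarify)
    fix e c :: "'s exponent" assume "e \<in> E"
    then have "(monomial e :: ('s, 'k) polyring) \<in> ring.span (monomial ` E)"
      by (intro ring.span_base) auto
    then show "(monomial (e + c) :: ('s, 'k) polyring) \<in> ring.span (monomial ` E)"
      unfolding monomial_add by (rule subspace_mult_right[OF ring.subspace_span])
  qed
qed

lemma monomial_span_cancel:
  "monomial_span U = (monomial_span V :: ('s, 'k::field) polyring set) \<longleftrightarrow> U = V"
  by (metis monomial_in_span set_eqI)

lemma monomial_ideal_iff:
  "monomial_ideal (I :: ('s, 'k::field) polyring set) \<longleftrightarrow> (\<exists>U. up_closed U \<and> I = monomial_span U)"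
proof
  assume "monomial_ideal I"
  then obtain E where "I = ideal_gen (monomial ` E)"
    by (auto simp: monomial_ideal_def subset_image_iff)
  moreover have "up_closed {e + c | e c. e \<in> E}"
    by (auto simp: up_closed_def, metis add.assoc)
  ultimately show "\<exists>U. up_closed U \<and> I = monomial_span U"
    by (auto simp: ideal_gen_monomials)
next
  assume "\<exists>U. up_closed U \<and> I = monomial_span U"
  then obtain U where U: "up_closed U" "I = monomial_span U" by blast
  have "{e + c | e c. e \<in> U} = U"
    using U(1) by (auto simp: up_closed_def) (metis add.right_neutral)
  then have "I = ideal_gen (monomial ` U)" by (simp add: ideal_gen_monomials U(2))
  then show "monomial_ideal I"
    unfolding monomial_ideal_def by (intro exI[of _ "monomial ` U"] conjI) auto
qed

section \<open>Minimal generators\<close>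

definition total_degree :: "('s::finite) exponent \<Rightarrow> nat"
  where "total_degree a = (\<Sum>i\<in>UNIV. Poly_Mapping.lookup a i)"

lemma total_degree_add: "total_degree (a + b) = total_degree a + total_degree b"
  by (simp add: total_degree_def lookup_add sum.distrib)

lemma total_degree_eq_0: "total_degree a = 0 \<longleftrightarrow> a = 0"
  by (auto simp: total_degree_def intro: poly_mapping_eqI)

text \<open>
  Splitting off a nonzero exponent lowers the total degree, so divisibility is well-founded.
\<close>

lemma above_minimal_exponent:
  fixes a :: "'s::finite exponent"
  assumes "a \<in> U"
  shows "\<exists>b\<in>minimal_exponents U. \<exists>c. a = b + c"
  using assms
proof (induction "total_degree a" arbitrary: a rule: less_induct)
  case less
  show ?case
  proof (cases "a \<in> minimal_exponents U")
    case True
    then show ?thesis by (metis add.right_neutral)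
  next
    case False
    then obtain b c where bc: "b \<in> U" "a = b + c" "c \<noteq> 0"
      using less.prems by (auto simp: minimal_exponents_def)
    then have "total_degree b < total_degree a"
      using total_degree_eq_0[of c] by (simp add: total_degree_add)
    from less.hyps[OF this bc(1)] show ?thesis
      unfolding bc(2) by (metis add.assoc)
  qed
qed

lemma minimal_exponents_generate:
  fixes U :: "'s::finite exponent set"
  assumes "up_closed U"
  shows "{e + c | e c. e \<in> minimal_exponents U} = U"
  using assms above_minimal_exponent[of _ U]
  by (auto simp: up_closed_def minimal_exponents_def) metis

lemma minimal_exponents_subset_generators:
  assumes "{e + c | e c. e \<in> E} = U"
  shows "minimal_exponents U \<subseteq> E"
proof
  fix a assume a: "a \<in> minimal_exponents U"
  then obtain e c where ec: "a = e + c" "e \<in> E"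
    using assms by (auto simp: minimal_exponents_def)
  have "e + 0 \<in> U" unfolding assms[symmetric] using ec(2) by blast
  with a ec have "c = 0" by (auto simp: minimal_exponents_def)
  with ec show "a \<in> E" by simp
qed

text \<open>
  The monomials of the minimal exponents generate, and every set of monomial generators contains
  them. So they are the only minimal generating set, which gives the description operator in
  \<^const>\<open>minimal_gens\<close> its meaning.
\<close>

lemma minimal_gens_monomial_span:
  fixes U :: "'s::finite exponent set"
  assumes "up_closed U"
  shows "minimal_gens (monomial_span U :: ('s, 'k::field) polyring set) = monomial ` minimal_exponents U"
  unfolding minimal_gens_def
proof (rule the_equality)
  let ?J = "monomial_span U :: ('s, 'k) polyring set"
  have gen: "ideal_gen (monomial ` E) = ?J \<longleftrightarrow> {e + c | e c. e \<in> E} = U" for E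
    by (simp only: ideal_gen_monomials monomial_span_cancel)
  show "is_minimal_monomial_gens ?J (monomial ` minimal_exponents U)"
    unfolding is_minimal_monomial_gens_def
  proof (intro conjI allI impI notI)
    show "monomial ` minimal_exponents U \<subseteq> (range monomial :: ('s, 'k) polyring set)" by blast
    show "ideal_gen (monomial ` minimal_exponents U) = ?J"
      using gen minimal_exponents_generate[OF assms] by blast
    fix H :: "('s, 'k) polyring set"
    assume H: "H \<subset> monomial ` minimal_exponents U" "ideal_gen H = ?J"
    then obtain E where "H = monomial ` E" "E \<subseteq> minimal_exponents U"
      by (metis psubsetE subset_imageE)
    moreover from this have "{e + c | e c. e \<in> E} = U" using H(2) gen[of E] by simp
    ultimately show False using minimal_exponents_subset_generators[of E U] H(1) by auto
  qed
  fix G assume G: "is_minimal_monomial_gens ?J G"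
  then obtain E where E: "G = monomial ` E"
    by (auto simp: is_minimal_monomial_gens_def subset_image_iff)
  with G have "{e + c | e c. e \<in> E} = U"
    using gen by (simp add: is_minimal_monomial_gens_def)
  then have "monomial ` minimal_exponents U \<subseteq> G"
    using minimal_exponents_subset_generators E by blast
  moreover have "ideal_gen (monomial ` minimal_exponents U) = ?J"
    using gen minimal_exponents_generate[OF assms] by blast
  ultimately show "G = monomial ` minimal_exponents U"
    using G unfolding is_minimal_monomial_gens_def by (metis psubsetI)
qed

lemma minimal_exponents_iff_decrement:
  assumes "up_closed U"
  shows "a \<in> minimal_exponents U \<longleftrightarrow>
    a \<in> U \<and> (\<forall>i b. a = b + Poly_Mapping.single i 1 \<longrightarrow> b \<notin> U)"
proof -
  have decrement: "\<exists>i b'. a = b' + Poly_Mapping.single i 1 \<and> b' \<in> U" if "b \<in> U" "a = b + c" "c \<noteq> 0" for b c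
  proof -
    obtain i where i: "Poly_Mapping.lookup c i \<noteq> 0"
      using \<open>c \<noteq> 0\<close> by (metis poly_mapping_eqI lookup_zero)
    have "c = (c - Poly_Mapping.single i 1) + Poly_Mapping.single i 1"
      using i by (intro poly_mapping_eqI) (auto simp: lookup_add lookup_minus lookup_single when_def)
    then have "a = (b + (c - Poly_Mapping.single i 1)) + Poly_Mapping.single i 1"
      using that(2) by (metis add.assoc)
    with assms \<open>b \<in> U\<close> show ?thesis unfolding up_closed_def by blast
  qed
  have single: "Poly_Mapping.single i (1::nat) \<noteq> 0" for i :: 's
    by (metis lookup_single_eq lookup_zero zero_neq_one)
  show ?thesis
  proof
    assume "a \<in> minimal_exponents U"
    then have "a \<in> U" and "\<And>b c. b \<in> U \<Longrightarrow> a = b + c \<Longrightarrow> c = 0"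
      by (simp_all add: minimal_exponents_def)
    with single show "a \<in> U \<and> (\<forall>i b. a = b + Poly_Mapping.single i 1 \<longrightarrow> b \<notin> U)" by metis
  next
    assume "a \<in> U \<and> (\<forall>i b. a = b + Poly_Mapping.single i 1 \<longrightarrow> b \<notin> U)"
    with decrement show "a \<in> minimal_exponents U"
      unfolding minimal_exponents_def by simp metis
  qed
qed

section \<open>Powers of ideals\<close>

primrec sumset_power :: "'s exponent set \<Rightarrow> nat \<Rightarrow> 's exponent set"
  where
    "sumset_power U 0 = UNIV"
  | "sumset_power U (Suc n) = {a + b | a b. a \<in> U \<and> b \<in> sumset_power U n}"

lemma up_closed_sumset_power: "up_closed U \<Longrightarrow> up_closed (sumset_power U n)"
  by (induction n) (auto simp: up_closed_def, metis add.assoc)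

lemma ideal_power_monomial_span:
  assumes "up_closed U"
  shows "ideal_power (monomial_span U) n = (monomial_span (sumset_power U n) :: ('s, 'k::field) polyring set)"
proof (induction n)
  case 0
  then show ?case by (simp add: monomial_span_def)
next
  case (Suc n)
  let ?V = "sumset_power U (Suc n)"
  let ?G = "{f * g | f g. f \<in> monomial_span U \<and> g \<in> (monomial_span (sumset_power U n) :: ('s, 'k) polyring set)}"
  have "ring.span ?G = monomial_span ?V"
  proof (rule ring.span_subspace)
    show "?G \<subseteq> monomial_span ?V"
    proof clarify
      fix f g :: "('s, 'k) polyring"
      assume "f \<in> monomial_span U" "g \<in> monomial_span (sumset_power U n)"
      then show "f * g \<in> monomial_span ?V"
        using keys_mult[of f g] by (fastforce simp: monomial_span_def)
    qed
    show "monomial_span ?V \<subseteq> ring.span ?G"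
    proof (rule monomial_span_subset_subspace[OF ring.subspace_span])
      fix c assume "c \<in> ?V"
      then obtain a b where ab: "c = a + b" "a \<in> U" "b \<in> sumset_power U n" by auto
      have "(monomial c :: ('s, 'k) polyring) \<in> ?G"
        unfolding ab(1) monomial_add using ab(2,3) by (intro CollectI exI conjI refl) auto
      then show "monomial c \<in> ring.span ?G" by (rule ring.span_base)
    qed
    show "ring.subspace (monomial_span ?V :: ('s, 'k) polyring set)"
      by (rule subspace_monomial_span[OF up_closed_sumset_power[OF assms]])
  qed
  then show ?case by (simp add: Suc.IH ideal_gen_def)
qed

section \<open>Integral dependence from an invariant finitely generated module\<close>

lemma subspace_ideal_power: "ring.subspace (ideal_power J n)"
  by (cases n) (simp_all add: ideal_gen_def)

lemma ideal_power_mult: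
  fixes J :: "'r::comm_ring_1 set"
  shows "a \<in> ideal_power J i \<Longrightarrow> b \<in> ideal_power J j \<Longrightarrow> a * b \<in> ideal_power J (i + j)"
proof (induction i arbitrary: a)
  case 0
  then show ?case by (simp add: ring.subspace_scale[OF subspace_ideal_power])
next
  case (Suc i)
  have "a \<in> ring.span {f * g | f g. f \<in> J \<and> g \<in> ideal_power J i}"
    using Suc.prems(1) by (simp add: ideal_gen_def)
  then show ?case
  proof (induction rule: ring.span_induct)
    case base
    show ?case
    proof (rule ring.subspaceI)
      show "0 \<in> {a. a * b \<in> ideal_power J (Suc i + j)}"
        unfolding mem_Collect_eq mult_zero_left by (rule ring.subspace_0[OF subspace_ideal_power])
      fix x y c
      assume x: "x \<in> {a. a * b \<in> ideal_power J (Suc i + j)}"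
      { assume "y \<in> {a. a * b \<in> ideal_power J (Suc i + j)}"
        with x show "x + y \<in> {a. a * b \<in> ideal_power J (Suc i + j)}"
          unfolding mem_Collect_eq distrib_right by (rule ring.subspace_add[OF subspace_ideal_power]) }
      show "c * x \<in> {a. a * b \<in> ideal_power J (Suc i + j)}"
        using x unfolding mem_Collect_eq mult.assoc by (rule ring.subspace_scale[OF subspace_ideal_power])
    qed
  next
    case (step x)
    then obtain f g where fg: "x = f * g" "f \<in> J" "g \<in> ideal_power J i" by blast
    have "g * b \<in> ideal_power J (i + j)" by (rule Suc.IH[OF fg(3) Suc.prems(2)])
    with fg(2) have "f * (g * b) \<in> {f * g | f g. f \<in> J \<and> g \<in> ideal_power J (i + j)}" by blast
    then have "f * (g * b) \<in> ideal_power J (Suc (i + j))"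
      unfolding ideal_power.simps ideal_gen_def by (rule ring.span_base)
    then show ?case by (simp only: fg(1) mult.assoc add_Suc)
  qed
qed

text \<open>
  The possible values of an integral equation of degree \<open>d\<close> without its leading term \<open>f\<^sup>d\<close>. An element
  of \<open>f\<^sup>d + lower_terms J f d\<close> is called monic of degree \<open>d\<close> below.
\<close>

definition lower_terms :: "'r::comm_ring_1 set \<Rightarrow> 'r \<Rightarrow> nat \<Rightarrow> 'r set"
  where "lower_terms J f d =
    {\<Sum>i\<in>{1..d}. a i * f ^ (d - i) | a. \<forall>i\<in>{1..d}. a i \<in> ideal_power J i}"

lemma subspace_lower_terms: "ring.subspace (lower_terms J f d)"
proof (rule ring.subspaceI)
  show "0 \<in> lower_terms J f d"
    by (auto simp: lower_terms_def ring.subspace_0[OF subspace_ideal_power] intro!: exI[of _ "\<lambda>_. 0"])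
next
  fix x y assume "x \<in> lower_terms J f d" "y \<in> lower_terms J f d"
  then obtain a b where a: "x = (\<Sum>i\<in>{1..d}. a i * f ^ (d - i))" "\<forall>i\<in>{1..d}. a i \<in> ideal_power J i"
    and b: "y = (\<Sum>i\<in>{1..d}. b i * f ^ (d - i))" "\<forall>i\<in>{1..d}. b i \<in> ideal_power J i"
    unfolding lower_terms_def by blast
  have "x + y = (\<Sum>i\<in>{1..d}. (a i + b i) * f ^ (d - i))"
    by (simp add: a(1) b(1) sum.distrib distrib_right)
  moreover have "\<forall>i\<in>{1..d}. a i + b i \<in> ideal_power J i"
    using a(2) b(2) ring.subspace_add[OF subspace_ideal_power] by blast
  ultimately show "x + y \<in> lower_terms J f d"
    unfolding lower_terms_def mem_Collect_eq by (intro exI[of _ "\<lambda>i. a i + b i"] conjI)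
next
  fix c x assume "x \<in> lower_terms J f d"
  then obtain a where a: "x = (\<Sum>i\<in>{1..d}. a i * f ^ (d - i))" "\<forall>i\<in>{1..d}. a i \<in> ideal_power J i"
    unfolding lower_terms_def by blast
  have "c * x = (\<Sum>i\<in>{1..d}. (c * a i) * f ^ (d - i))"
    by (simp add: a(1) sum_distrib_left mult.assoc)
  moreover have "\<forall>i\<in>{1..d}. c * a i \<in> ideal_power J i"
    using a(2) ring.subspace_scale[OF subspace_ideal_power] by blast
  ultimately show "c * x \<in> lower_terms J f d"
    unfolding lower_terms_def mem_Collect_eq by (intro exI[of _ "\<lambda>i. c * a i"] conjI)
qed

lemma lower_terms_single:
  assumes "a \<in> ideal_power J i" and "1 \<le> i" and "i \<le> d"
  shows "a * f ^ (d - i) \<in> lower_terms J f d"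
proof -
  have "(\<Sum>k\<in>{1..d}. (if k = i then a else 0) * f ^ (d - k)) = a * f ^ (d - i)"
    using assms by (simp add: if_distrib[of "\<lambda>r. r * _"] cong: if_cong)
  then show ?thesis
    unfolding lower_terms_def using assms
    by (intro CollectI exI[of _ "\<lambda>k. if k = i then a else 0"])
      (auto simp: ring.subspace_0[OF subspace_ideal_power])
qed

lemma lower_terms_mult_power:
  assumes "x \<in> lower_terms J f d"
  shows "x * f ^ e \<in> lower_terms J f (d + e)"
proof -
  obtain a where a: "x = (\<Sum>i\<in>{1..d}. a i * f ^ (d - i))" "\<forall>i\<in>{1..d}. a i \<in> ideal_power J i"
    using assms by (auto simp: lower_terms_def)
  have "x * f ^ e = (\<Sum>i\<in>{1..d}. a i * f ^ (d + e - i))"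
    unfolding a(1) sum_distrib_right by (intro sum.cong) (auto simp: mult.assoc simp flip: power_add)
  also have "\<dots> \<in> lower_terms J f (d + e)"
    using a(2) by (intro ring.subspace_sum[OF subspace_lower_terms] lower_terms_single) auto
  finally show ?thesis .
qed

lemma lower_terms_mult:
  assumes "x \<in> lower_terms J f d" and "y \<in> lower_terms J f e"
  shows "x * y \<in> lower_terms J f (d + e)"
proof -
  obtain a where a: "x = (\<Sum>i\<in>{1..d}. a i * f ^ (d - i))" "\<forall>i\<in>{1..d}. a i \<in> ideal_power J i"
    using assms by (auto simp: lower_terms_def)
  obtain b where b: "y = (\<Sum>i\<in>{1..e}. b i * f ^ (e - i))" "\<forall>i\<in>{1..e}. b i \<in> ideal_power J i"
    using assms by (auto simp: lower_terms_def)
  have "x * y = (\<Sum>i\<in>{1..d}. \<Sum>j\<in>{1..e}. (a i * b j) * f ^ ((d + e) - (i + j)))"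
    unfolding a(1) b(1) sum_product
  proof (intro sum.cong refl)
    fix i j assume ij: "i \<in> {1..d}" "j \<in> {1..e}"
    then have "(d + e) - (i + j) = (d - i) + (e - j)" by auto
    then show "a i * f ^ (d - i) * (b j * f ^ (e - j)) = a i * b j * f ^ ((d + e) - (i + j))"
      by (simp add: power_add mult_ac)
  qed
  also have "\<dots> \<in> lower_terms J f (d + e)"
    using a(2) b(2)
    by (intro ring.subspace_sum[OF subspace_lower_terms] lower_terms_single ideal_power_mult) auto
  finally show ?thesis .
qed

text \<open>
  A square homogeneous linear system whose diagonal is monic of degree \<open>d\<close> and whose other entries are
  lower terms of degree \<open>d\<close>. Multiplying crosswise to eliminate one unknown yields entries
  \<open>P x x * P i j - P i x * P x j\<close>; since lower terms are closed under products with lower terms and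
  with powers of \<open>f\<close>, the smaller system has the same shape with degree \<open>2 * d\<close>. When a single unknown
  is left, its coefficient is monic, of degree \<open>d * 2 ^ card B\<close>, and annihilates it.
\<close>

lemma elimination:
  fixes P :: "'i \<Rightarrow> 'i \<Rightarrow> 'r::comm_ring_1"
  assumes "finite B" and "b0 \<notin> B" and "1 \<le> d"
    and "\<And>i. i \<in> insert b0 B \<Longrightarrow> P i i - f ^ d \<in> lower_terms J f d"
    and "\<And>i j. i \<in> insert b0 B \<Longrightarrow> j \<in> insert b0 B \<Longrightarrow> i \<noteq> j \<Longrightarrow> P i j \<in> lower_terms J f d"
    and "\<And>i. i \<in> insert b0 B \<Longrightarrow> (\<Sum>j\<in>insert b0 B. P i j * g j) = 0"
  shows "\<exists>e\<ge>1. \<exists>h. h - f ^ e \<in> lower_terms J f e \<and> h * g b0 = 0"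
  using assms
proof (induction B arbitrary: d P rule: finite_induct)
  case empty
  show ?case
    using empty.prems(2) empty.prems(3)[of b0] empty.prems(5)[of b0]
    by (intro exI[of _ d] exI[of _ "P b0 b0"]) auto
next
  case (insert x B)
  let ?L = "lower_terms J f"
  define Q where "Q i j = P x x * P i j - P i x * P x j" for i j
  note diag = insert.prems(3) and off = insert.prems(4) and zero = insert.prems(5)
  have xx: "P x x - f ^ d \<in> ?L d" using diag[of x] by simp
  have prod: "P i x * P x j \<in> ?L (2 * d)" if "i \<in> insert b0 B" "j \<in> insert b0 B" for i j
  proof -
    have "i \<noteq> x" "j \<noteq> x" using that insert.hyps insert.prems(1) by auto
    then show ?thesis
      using that off[of i x] off[of x j] lower_terms_mult[of "P i x" J f d "P x j" d] by (simp add: mult_2)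
  qed
  have Qd: "Q i i - f ^ (2 * d) \<in> ?L (2 * d)" if "i \<in> insert b0 B" for i
  proof -
    let ?u = "P x x - f ^ d" and ?v = "P i i - f ^ d"
    have v: "?v \<in> ?L d" using diag[of i] that by auto
    have "?u * ?v + ?u * f ^ d + ?v * f ^ d - P i x * P x i \<in> ?L (2 * d)"
      using lower_terms_mult[OF xx v] lower_terms_mult_power[OF xx, of d]
        lower_terms_mult_power[OF v, of d] prod[OF that that]
      by (intro ring.subspace_diff[OF subspace_lower_terms] ring.subspace_add[OF subspace_lower_terms])
        (simp_all add: mult_2)
    also have "?u * ?v + ?u * f ^ d + ?v * f ^ d - P i x * P x i = Q i i - f ^ (2 * d)"
      unfolding Q_def mult_2 power_add by (simp add: algebra_simps)
    finally show ?thesis .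
  qed
  have Qo: "Q i j \<in> ?L (2 * d)" if "i \<in> insert b0 B" "j \<in> insert b0 B" "i \<noteq> j" for i j
  proof -
    let ?u = "P x x - f ^ d"
    have v: "P i j \<in> ?L d" using off[of i j] that by auto
    have "?u * P i j + P i j * f ^ d - P i x * P x j \<in> ?L (2 * d)"
      using lower_terms_mult[OF xx v] lower_terms_mult_power[OF v, of d] prod[OF that(1,2)]
      by (intro ring.subspace_diff[OF subspace_lower_terms] ring.subspace_add[OF subspace_lower_terms])
        (simp_all add: mult_2)
    also have "?u * P i j + P i j * f ^ d - P i x * P x j = Q i j"
      by (simp add: Q_def algebra_simps)
    finally show ?thesis .
  qed
  have Qz: "(\<Sum>j\<in>insert b0 B. Q i j * g j) = 0" if i: "i \<in> insert b0 B" for i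
  proof -
    have split: "(\<Sum>j\<in>insert b0 B. P k j * g j) = - (P k x * g x)" if "k \<in> insert b0 (insert x B)" for k
    proof -
      have "(\<Sum>j\<in>insert b0 (insert x B). P k j * g j) = P k x * g x + (\<Sum>j\<in>insert b0 B. P k j * g j)"
        using insert.hyps insert.prems(1) by (subst insert_commute, subst sum.insert) auto
      with zero[OF that] show ?thesis by (simp add: eq_neg_iff_add_eq_0 add.commute)
    qed
    have "(\<Sum>j\<in>insert b0 B. Q i j * g j) =
        P x x * (\<Sum>j\<in>insert b0 B. P i j * g j) - P i x * (\<Sum>j\<in>insert b0 B. P x j * g j)"
      unfolding Q_def sum_distrib_left sum_subtractf[symmetric] by (simp only: algebra_simps)
    also have "\<dots> = 0"
    proof -
      have "i \<in> insert b0 (insert x B)" "x \<in> insert b0 (insert x B)" using i by auto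
      from split[OF this(1)] split[OF this(2)] show ?thesis by (simp add: algebra_simps)
    qed
    finally show ?thesis .
  qed
  show ?case
    by (rule insert.IH[of "2 * d" Q]) (use Qd Qo Qz insert.prems(1,2) in \<open>simp_all\<close>)
qed

text \<open>
  If \<open>f\<close> maps the module generated by the \<open>g i\<close> into \<open>J\<close> times itself, the matrix of \<open>f - A\<close> kills the
  vector of generators and has the shape required for elimination, with \<open>d = 1\<close>.
\<close>

lemma integral_equation_annihilates:
  fixes f :: "'r::comm_ring_1"
  assumes "finite B" and "b0 \<in> B" and A: "\<And>i j. i \<in> B \<Longrightarrow> j \<in> B \<Longrightarrow> A i j \<in> J"
    and eq: "\<And>i. i \<in> B \<Longrightarrow> f * g i = (\<Sum>j\<in>B. A i j * g j)"
  shows "\<exists>k\<ge>1. \<exists>a. (\<forall>i\<in>{1..k}. a i \<in> ideal_power J i) \<and>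
    (f ^ k + (\<Sum>i\<in>{1..k}. a i * f ^ (k - i))) * g b0 = 0"
proof -
  have J: "- x \<in> lower_terms J f 1" if "x \<in> J" for x
  proof -
    have "x * 1 \<in> {f * g | f g. f \<in> J \<and> g \<in> ideal_power J 0}"
      using that by (intro CollectI exI[of _ x] exI[of _ 1]) simp
    then have "x * 1 \<in> ideal_power J (Suc 0)"
      unfolding ideal_power.simps(2) ideal_gen_def by (rule ring.span_base)
    then have "x \<in> ideal_power J 1" by simp
    then have "x * f ^ (1 - 1) \<in> lower_terms J f 1" by (intro lower_terms_single) auto
    then show ?thesis using ring.subspace_neg[OF subspace_lower_terms] by simp
  qed
  define P where "P i j = (if i = j then f else 0) - A i j" for i j
  have ins: "insert b0 (B - {b0}) = B" using \<open>b0 \<in> B\<close> by blast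
  have "\<exists>e\<ge>1. \<exists>h. h - f ^ e \<in> lower_terms J f e \<and> h * g b0 = 0"
  proof (rule elimination[of "B - {b0}" b0 1 P], unfold ins)
    fix i assume i: "i \<in> B"
    show "P i i - f ^ 1 \<in> lower_terms J f 1" using J[OF A[OF i i]] by (simp add: P_def)
    show "(\<Sum>j\<in>B. P i j * g j) = 0"
      using i eq[OF i] \<open>finite B\<close>
      by (simp add: P_def left_diff_distrib sum_subtractf if_distrib[of "\<lambda>r. r * _"] cong: if_cong)
    fix j assume "j \<in> B" "i \<noteq> j"
    then show "P i j \<in> lower_terms J f 1" using J[OF A[OF i \<open>j \<in> B\<close>]] by (simp add: P_def)
  qed (use \<open>finite B\<close> in auto)
  then obtain e h where e: "1 \<le> e" and h: "h - f ^ e \<in> lower_terms J f e" and hg: "h * g b0 = 0" by blast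
  then obtain a where a: "h - f ^ e = (\<Sum>i\<in>{1..e}. a i * f ^ (e - i))" "\<forall>i\<in>{1..e}. a i \<in> ideal_power J i"
    by (auto simp: lower_terms_def)
  have "h = f ^ e + (\<Sum>i\<in>{1..e}. a i * f ^ (e - i))" using a(1) by (simp add: algebra_simps)
  with e hg a(2) show ?thesis by blast
qed

section \<open>Weights of integral elements\<close>

lemma lookup_mult_keys:
  fixes f g :: "('s, 'k::field) polyring"
  shows "Poly_Mapping.lookup (f * g) x = (\<Sum>a\<in>Poly_Mapping.keys f. \<Sum>b\<in>Poly_Mapping.keys g.
    if a + b = x then Poly_Mapping.lookup f a * Poly_Mapping.lookup g b else 0)"
proof -
  have exp: "h = (\<Sum>a\<in>Poly_Mapping.keys h. Poly_Mapping.single a (Poly_Mapping.lookup h a))"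
    for h :: "('s, 'k) polyring"
    using polynomial_expansion[of h] by (simp add: monomial_def mult_single)
  have "f * g = (\<Sum>a\<in>Poly_Mapping.keys f. Poly_Mapping.single a (Poly_Mapping.lookup f a)) *
      (\<Sum>b\<in>Poly_Mapping.keys g. Poly_Mapping.single b (Poly_Mapping.lookup g b))"
    by (rule arg_cong2[of _ _ _ _ "(*)"]) (rule exp)+
  then show ?thesis
    by (simp add: sum_product mult_single lookup_sum lookup_single when_def)
qed

text \<open>
  If \<open>u + z\<close> arises in only one way as a sum of exponents of the factors, nothing can cancel there.
\<close>

lemma lookup_mult_unique:
  fixes f g :: "('s, 'k::field) polyring"
  assumes "\<And>b c. b \<in> Poly_Mapping.keys f \<Longrightarrow> c \<in> Poly_Mapping.keys g \<Longrightarrow> b + c = u + z \<Longrightarrow> b = u"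
  shows "Poly_Mapping.lookup (f * g) (u + z) = Poly_Mapping.lookup f u * Poly_Mapping.lookup g z"
proof -
  have "Poly_Mapping.lookup (f * g) (u + z) =
      (\<Sum>b\<in>Poly_Mapping.keys f. if b = u then (\<Sum>c\<in>Poly_Mapping.keys g.
        if c = z then Poly_Mapping.lookup f u * Poly_Mapping.lookup g z else 0) else 0)"
    unfolding lookup_mult_keys using assms by (intro sum.cong refl) (auto intro!: sum.cong sum.neutral)
  also have "\<dots> = Poly_Mapping.lookup f u * Poly_Mapping.lookup g z"
    by (auto simp: in_keys_iff)
  finally show ?thesis .
qed

lemma mult_monomial_eq_0:
  fixes p :: "('s, 'k::field) polyring"
  assumes "p * monomial b = 0"
  shows "p = 0"
proof (rule poly_mapping_eqI)
  fix a
  have "Poly_Mapping.lookup (p * monomial b) (a + b) =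
      Poly_Mapping.lookup p a * Poly_Mapping.lookup (monomial b) b"
    by (rule lookup_mult_unique) simp
  then show "Poly_Mapping.lookup p a = Poly_Mapping.lookup 0 a"
    using assms by (simp add: monomial_def)
qed

lemma real_vec_nth [simp]: "real_vec a $ i = real (Poly_Mapping.lookup a i)"
  by (simp add: real_vec_def)

lemma real_vec_add: "real_vec (a + b) = real_vec a + real_vec b"
  by (simp add: vec_eq_iff lookup_add)

lemma real_vec_nonneg [simp]: "0 \<le> real_vec a"
  by (simp add: less_eq_vec_def)

lemma real_vec_eq_iff: "real_vec a = real_vec b \<longleftrightarrow> a = b"
  by (auto simp: vec_eq_iff intro: poly_mapping_eqI)

lemma real_vec_zero [simp]: "real_vec 0 = 0"
  by (simp add: vec_eq_iff)

lemma real_vec_eq_0_iff: "real_vec a = 0 \<longleftrightarrow> a = 0"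
  using real_vec_eq_iff[of a 0] by simp

lemma real_vec_single: "real_vec (Poly_Mapping.single i 1) = axis i 1"
  by (simp add: vec_eq_iff axis_def lookup_single when_def)

lemma inner_eq_self_imp_eq:
  fixes x u :: "'a::real_inner"
  assumes "norm x \<le> norm u" and "u \<bullet> u \<le> x \<bullet> u"
  shows "x = u"
proof -
  have "(norm (x - u))\<^sup>2 = (norm x)\<^sup>2 - 2 * (x \<bullet> u) + (norm u)\<^sup>2"
    by (simp add: power2_norm_eq_inner inner_diff_left inner_diff_right inner_commute)
  also have "\<dots> \<le> 0"
    using power_mono[OF assms(1), of 2] assms(2) by (simp add: power2_norm_eq_inner)
  finally show ?thesis by simp
qed

text \<open>
  Suppose \<open>f\<close> has an exponent of weight below \<open>c\<close>. Among its exponents of least weight choose the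
  longest one, \<open>u\<close>, in the Euclidean norm. By Cauchy-Schwarz \<open>b \<mapsto> \<langle>b, u\<rangle>\<close> attains its maximum over
  these exponents only at \<open>u\<close>, so \<open>u\<close> is a vertex of the lowest face, and \<open>u + \<dots> + u\<close> is the only way to
  reach \<open>k u\<close> by adding \<open>k\<close> exponents of \<open>f\<close>. Hence \<open>f\<^sup>k\<close> has a nonzero coefficient at \<open>k u\<close>. The other
  terms \<open>r\<^sub>i f\<^sup>k\<^sup>-\<^sup>i\<close> of an integral equation have weight at least \<open>i c + (k - i) w u > k w u\<close> and
  cannot cancel it.
\<close>

lemma weight_of_integral_element:
  fixes f :: "('s::finite, 'k::field) polyring" and w :: "'s exponent \<Rightarrow> real"
  assumes up: "up_closed F" and add: "\<And>a b. w (a + b) = w a + w b"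
    and bound: "\<And>a. a \<in> F \<Longrightarrow> c \<le> w a"
    and f: "f \<in> integral_closure (monomial_span F)" and a: "a \<in> Poly_Mapping.keys f"
  shows "c \<le> w a"
proof (rule ccontr)
  assume "\<not> c \<le> w a"
  let ?K = "Poly_Mapping.keys f"
  define T where "T = {b \<in> ?K. w b = Min (w ` ?K)}"
  have "Min (w ` ?K) \<in> w ` ?K" using a by (intro Min_in) auto
  then have "T \<noteq> {}" by (auto simp: T_def)
  moreover have "finite T" by (simp add: T_def)
  ultimately have "Max ((\<lambda>b. norm (real_vec b)) ` T) \<in> (\<lambda>b. norm (real_vec b)) ` T" by (intro Max_in) auto
  then obtain u where uT: "u \<in> T" and "Max ((\<lambda>b. norm (real_vec b)) ` T) = norm (real_vec u)" by blast
  then have u_max: "norm (real_vec b) \<le> norm (real_vec u)" if "b \<in> T" for b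
    using that \<open>finite T\<close> Max_ge[of "(\<lambda>b. norm (real_vec b)) ` T" "norm (real_vec b)"] by auto
  have u: "u \<in> ?K" using uT by (simp add: T_def)
  have w_min: "w u \<le> w b" if "b \<in> ?K" for b
    using uT that by (simp add: T_def)
  have wu: "w u < c" using w_min[OF a] \<open>\<not> c \<le> w a\<close> by simp
  define z where "z b = real_vec b \<bullet> real_vec u" for b
  have z_add: "z (b + d) = z b + z d" for b d
    by (simp add: z_def real_vec_add inner_add_left)
  have face: "z b \<le> z u" "z b = z u \<Longrightarrow> b = u" if "b \<in> ?K" "w b = w u" for b
  proof -
    have "b \<in> T" using that uT by (simp add: T_def)
    note n = u_max[OF this]
    have "z b \<le> norm (real_vec b) * norm (real_vec u)"
      unfolding z_def by (rule norm_cauchy_schwarz)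
    also have "\<dots> \<le> norm (real_vec u) * norm (real_vec u)"
      using n by (intro mult_right_mono) auto
    finally show "z b \<le> z u" by (simp add: z_def flip: power2_norm_eq_inner power2_eq_square)
    show "b = u" if "z b = z u"
      using inner_eq_self_imp_eq[OF n] that by (simp add: z_def real_vec_eq_iff)
  qed
  define ku where "ku k = (\<Sum>i<k. u)" for k :: nat
  have ku: "ku 0 = 0" "ku (Suc k) = u + ku k" for k
    by (simp_all add: ku_def add.commute)
  have w0: "w 0 = 0" "z 0 = 0" using add[of 0 0] by (simp_all add: z_def)
  have w_ku: "w (ku k) = k * w u" "z (ku k) = k * z u" for k
    by (induction k) (simp_all add: ku w0 add z_add algebra_simps)
  have power: "(\<forall>b\<in>Poly_Mapping.keys (f ^ k). k * w u \<le> w b \<and> (w b = k * w u \<longrightarrow> z b \<le> k * z u)) \<and>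
      Poly_Mapping.lookup (f ^ k) (ku k) = Poly_Mapping.lookup f u ^ k" for k
  proof (induction k)
    case 0
    then show ?case by (simp add: w0 ku)
  next
    case (Suc k)
    have split: "w b = w u \<and> w d = k * w u" "z b = z u"
      if "b \<in> ?K" "d \<in> Poly_Mapping.keys (f ^ k)" "w (b + d) = Suc k * w u"
        and "z (b + d) \<ge> Suc k * z u" for b d
    proof -
      have "w u \<le> w b" "k * w u \<le> w d" using w_min that Suc.IH by auto
      with that(3) show w: "w b = w u \<and> w d = k * w u" by (simp add: add algebra_simps)
      then have "z b \<le> z u" "z d \<le> k * z u" using face(1) that Suc.IH by auto
      with that(4) show "z b = z u" by (simp add: z_add algebra_simps)
    qed
    have "Suc k * w u \<le> w x \<and> (w x = Suc k * w u \<longrightarrow> z x \<le> Suc k * z u)"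
      if x: "x \<in> Poly_Mapping.keys (f ^ Suc k)" for x
    proof -
      obtain b d where bd: "x = b + d" "b \<in> ?K" "d \<in> Poly_Mapping.keys (f ^ k)"
        using x keys_mult[of f "f ^ k"] by auto
      have le: "w u \<le> w b" "k * w u \<le> w d" using w_min bd Suc.IH by auto
      have "z x \<le> Suc k * z u" if "w x = Suc k * w u"
      proof -
        have "w b = w u" "w d = k * w u" using le that by (simp_all add: bd(1) add algebra_simps)
        then have "z b \<le> z u" "z d \<le> k * z u" using face(1) bd Suc.IH by auto
        then show ?thesis by (simp add: bd(1) z_add algebra_simps)
      qed
      with le show ?thesis by (simp add: bd(1) add algebra_simps)
    qed
    moreover have "Poly_Mapping.lookup (f * f ^ k) (u + ku k) =
        Poly_Mapping.lookup f u * Poly_Mapping.lookup (f ^ k) (ku k)"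
    proof (rule lookup_mult_unique)
      fix b d assume bd: "b \<in> ?K" "d \<in> Poly_Mapping.keys (f ^ k)" "b + d = u + ku k"
      have "w (b + d) = Suc k * w u" "z (b + d) = Suc k * z u"
        unfolding bd(3) by (simp_all add: add z_add w_ku algebra_simps)
      with split[OF bd(1,2)] face(2)[OF bd(1)] show "b = u" by simp
    qed
    ultimately show ?case using Suc.IH by (simp add: ku)
  qed
  obtain k r where "1 \<le> k" and r: "\<forall>i\<in>{1..k}. r i \<in> ideal_power (monomial_span F) i"
    and eq: "f ^ k + (\<Sum>i\<in>{1..k}. r i * f ^ (k - i)) = 0"
    using f by (auto simp: integral_closure_def)
  have weight: "i * c \<le> w b" if "b \<in> sumset_power F i" "1 \<le> i" for i b
    using that(2,1)
  proof (induction i arbitrary: b rule: dec_induct)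
    case base
    then obtain b1 b2 where "b = b1 + b2" "b1 \<in> F" by auto
    then have "b \<in> F" using up by (simp add: up_closed_def)
    then show ?case using bound by simp
  next
    case (step i)
    then obtain b1 b2 where b: "b = b1 + b2" "b1 \<in> F" "b2 \<in> sumset_power F i" by auto
    show ?case using step.IH[OF b(3)] bound[OF b(2)] by (simp add: b(1) add algebra_simps)
  qed
  have "Poly_Mapping.lookup (r i * f ^ (k - i)) (ku k) = 0" if i: "i \<in> {1..k}" for i
  proof (rule ccontr)
    assume "Poly_Mapping.lookup (r i * f ^ (k - i)) (ku k) \<noteq> 0"
    then have "ku k \<in> Poly_Mapping.keys (r i * f ^ (k - i))" by (simp add: in_keys_iff)
    then obtain b d where bd: "ku k = b + d" "b \<in> Poly_Mapping.keys (r i)" "d \<in> Poly_Mapping.keys (f ^ (k - i))"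
      using keys_mult by blast
    have "r i \<in> monomial_span (sumset_power F i)"
      using r i by (simp add: ideal_power_monomial_span[OF up])
    then have "b \<in> sumset_power F i" using bd(2) by (auto simp: monomial_span_def)
    then have "i * c \<le> w b" using weight i by simp
    moreover have "(k - i) * w u \<le> w d" using power[of "k - i"] bd(3) by blast
    then have "k * w u - i * w u \<le> w d" using i by (simp add: of_nat_diff left_diff_distrib)
    moreover have "k * w u = w b + w d" using w_ku(1)[of k] by (simp add: bd(1) add)
    ultimately have "real i * c \<le> real i * w u" by linarith
    then show False using i wu by simp
  qed
  then have "Poly_Mapping.lookup (f ^ k + (\<Sum>i\<in>{1..k}. r i * f ^ (k - i))) (ku k) = Poly_Mapping.lookup f u ^ k"
    using power[of k] by (simp add: lookup_add lookup_sum)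
  then show False using eq u by (simp add: in_keys_iff)
qed

section \<open>Dilations of the Newton polyhedron\<close>

text \<open>
  For \<open>c > 0\<close>, the lattice points of \<open>c\<close> times the Newton polyhedron of the exponents \<open>v 1, \<dots>, v q\<close>.
  Requiring only an inequality for the coordinate sum of \<open>y\<close> makes this the set of exponents at which
  the primal program has a feasible point of value at least \<open>c\<close>.
\<close>

definition newton_exponents :: "(nat \<Rightarrow> 's::finite exponent) \<Rightarrow> nat \<Rightarrow> real \<Rightarrow> 's exponent set"
  where "newton_exponents v q c = {a. \<exists>y. (\<forall>j\<in>{1..q}. 0 \<le> y j) \<and> c \<le> (\<Sum>j\<in>{1..q}. y j) \<and>
    (\<Sum>j\<in>{1..q}. y j *\<^sub>R real_vec (v j)) \<le> real_vec a}"

lemma newton_exponentsI: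
  assumes "\<And>j. j \<in> {1..q} \<Longrightarrow> 0 \<le> y j" and "c \<le> (\<Sum>j\<in>{1..q}. y j)"
    and "(\<Sum>j\<in>{1..q}. y j *\<^sub>R real_vec (v j)) \<le> real_vec a"
  shows "a \<in> newton_exponents v q c"
  unfolding newton_exponents_def using assms by blast

lemma newton_exponentsE:
  assumes "a \<in> newton_exponents v q c"
  obtains y where "\<forall>j\<in>{1..q}. 0 \<le> y j" and "c \<le> (\<Sum>j\<in>{1..q}. y j)"
    and "(\<Sum>j\<in>{1..q}. y j *\<^sub>R real_vec (v j)) \<le> real_vec a"
  using assms unfolding newton_exponents_def by blast

lemma newton_exponents_add:
  assumes "a \<in> newton_exponents v q c" and "b \<in> newton_exponents v q d"
  shows "a + b \<in> newton_exponents v q (c + d)"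
proof -
  obtain y where y: "\<forall>j\<in>{1..q}. 0 \<le> y j" "c \<le> (\<Sum>j\<in>{1..q}. y j)"
    "(\<Sum>j\<in>{1..q}. y j *\<^sub>R real_vec (v j)) \<le> real_vec a"  using newton_exponentsE[OF assms(1)] .
  obtain y' where y': "\<forall>j\<in>{1..q}. 0 \<le> y' j" "d \<le> (\<Sum>j\<in>{1..q}. y' j)"
    "(\<Sum>j\<in>{1..q}. y' j *\<^sub>R real_vec (v j)) \<le> real_vec b"  using newton_exponentsE[OF assms(2)] .
  show ?thesis
  proof (rule newton_exponentsI[where y = "\<lambda>j. y j + y' j"])
    show "(\<Sum>j\<in>{1..q}. (y j + y' j) *\<^sub>R real_vec (v j)) \<le> real_vec (a + b)"
      using add_mono[OF y(3) y'(3)] by (simp add: scaleR_add_left sum.distrib real_vec_add)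
  qed (use y y' in \<open>auto simp: sum.distrib intro: add_mono\<close>)
qed

lemma up_closed_newton_exponents: "up_closed (newton_exponents v q c)"
proof -
  have "d \<in> newton_exponents v q 0" for d
    by (rule newton_exponentsI[where y = "\<lambda>_. 0"]) auto
  then show ?thesis
    using newton_exponents_add[where d = 0] by (fastforce simp: up_closed_def)
qed

text \<open>
  If \<open>q\<close> coordinates sum to at least \<open>q\<close>, one of them is at least \<open>1\<close>; lower that one by \<open>1\<close>.
\<close>

lemma newton_exponents_split_generator:
  assumes a: "a \<in> newton_exponents v q c" and "real q \<le> c" and "1 \<le> q"
  shows "\<exists>j\<in>{1..q}. \<exists>b\<in>newton_exponents v q (c - 1). a = v j + b"
proof -
  obtain y where y: "\<forall>j\<in>{1..q}. 0 \<le> y j" "c \<le> (\<Sum>j\<in>{1..q}. y j)"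
    "(\<Sum>j\<in>{1..q}. y j *\<^sub>R real_vec (v j)) \<le> real_vec a"  using newton_exponentsE[OF a] .
  have "\<exists>j\<in>{1..q}. 1 \<le> y j"
  proof (rule ccontr)
    assume "\<not> ?thesis"
    then have "(\<Sum>j\<in>{1..q}. y j) < (\<Sum>j\<in>{1..q}. 1)"
      using \<open>1 \<le> q\<close> by (intro sum_strict_mono) (auto simp: not_le)
    then show False using y(2) \<open>real q \<le> c\<close> by simp
  qed
  then obtain j where j: "j \<in> {1..q}" "1 \<le> y j" by blast
  define y' where "y' k = y k - (if k = j then 1 else 0)" for k
  have y'0: "0 \<le> y' k" if "k \<in> {1..q}" for k
    using bspec[OF y(1) that] j(2) by (simp add: y'_def)
  have sum: "(\<Sum>k\<in>{1..q}. y' k) = (\<Sum>k\<in>{1..q}. y k) - 1"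
    using j(1) by (simp add: y'_def sum_subtractf)
  have comb: "(\<Sum>k\<in>{1..q}. y' k *\<^sub>R real_vec (v k)) = (\<Sum>k\<in>{1..q}. y k *\<^sub>R real_vec (v k)) - real_vec (v j)"
    using j(1) by (simp add: y'_def scaleR_diff_left sum_subtractf if_distrib[of "\<lambda>r. r *\<^sub>R _"] cong: if_cong)
  have "0 \<le> (\<Sum>k\<in>{1..q}. y' k *\<^sub>R real_vec (v k))"
    using y'0 by (intro sum_nonneg scaleR_nonneg_nonneg) auto
  then have "real_vec (v j) \<le> real_vec a" using comb y(3) by (simp add: order_trans)
  then have "Poly_Mapping.lookup (v j) i \<le> Poly_Mapping.lookup a i" for i
    by (simp add: less_eq_vec_def)
  then have eq: "a = v j + (a - v j)"
    by (intro poly_mapping_eqI) (simp add: lookup_add lookup_minus)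
  have "a - v j \<in> newton_exponents v q (c - 1)"
  proof (rule newton_exponentsI[of q y'])
    have "real_vec a = real_vec (v j) + real_vec (a - v j)" by (subst eq) (rule real_vec_add)
    then show "(\<Sum>j\<in>{1..q}. y' j *\<^sub>R real_vec (v j)) \<le> real_vec (a - v j)"
      using comb y(3) by (simp add: diff_le_eq add.commute)
  qed (use y'0 y(2) sum in auto)
  with eq j(1) show ?thesis by blast
qed

lemma newton_exponents_split_power:
  assumes "1 \<le> q" and "U = {v j + c | j c. j \<in> {1..q}}"
  shows "a \<in> newton_exponents v q (real n + real q) \<Longrightarrow>
    \<exists>e\<in>sumset_power U n. \<exists>b\<in>newton_exponents v q (real q). a = e + b"
proof (induction n arbitrary: a)
  case 0
  then show ?case by (intro bexI[of _ 0] bexI[of _ a]) auto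
next
  case (Suc n)
  obtain j b where jb: "j \<in> {1..q}" "b \<in> newton_exponents v q (real n + real q)" "a = v j + b"
    using newton_exponents_split_generator[OF Suc.prems _ assms(1)] by auto
  obtain e d where ed: "e \<in> sumset_power U n" "d \<in> newton_exponents v q (real q)" "b = e + d"
    using Suc.IH[OF jb(2)] by blast
  have "v j + 0 \<in> U" unfolding assms(2) using jb(1) by blast
  then have "v j + e \<in> sumset_power U (Suc n)" using ed(1) by auto
  moreover have "a = (v j + e) + d" by (simp add: jb(3) ed(3) add.assoc)
  ultimately show ?case using ed(2) by blast
qed

lemma finite_bounded_exponents: "finite {b :: 's::finite exponent. \<forall>i. real (Poly_Mapping.lookup b i) \<le> R}"
proof (rule finite_subset)
  show "{b :: 's exponent. \<forall>i. real (Poly_Mapping.lookup b i) \<le> R} \<subseteq>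
      Poly_Mapping.lookup -` (PiE UNIV (\<lambda>_. {..nat \<lfloor>R\<rfloor>}))"
    by (auto simp: PiE_def le_nat_floor)
  have "inj (Poly_Mapping.lookup :: 's exponent \<Rightarrow> 's \<Rightarrow> nat)"
    by (auto intro: injI poly_mapping_eqI)
  then show "finite (Poly_Mapping.lookup -` (PiE UNIV (\<lambda>_. {..nat \<lfloor>R\<rfloor>})) :: 's exponent set)"
    by (intro finite_vimageI finite_PiE) auto
qed

text \<open>
  Scaling \<open>y\<close> down to coordinate sum exactly \<open>c\<close> keeps it feasible and bounds \<open>A y\<close> independently of \<open>y\<close>.
  An exponent exceeding this bound by more than \<open>1\<close> in some coordinate can be lowered there.
\<close>

lemma finite_minimal_newton_exponents:
  fixes v :: "nat \<Rightarrow> 's::finite exponent"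
  assumes "0 \<le> c"
  shows "finite (minimal_exponents (newton_exponents v q c))"
proof (rule finite_subset)
  define R where "R = (\<Sum>i\<in>UNIV. \<Sum>j\<in>{1..q}. c * real (Poly_Mapping.lookup (v j) i)) + 1"
  show "finite {b :: 's exponent. \<forall>i. real (Poly_Mapping.lookup b i) \<le> R}"
    by (rule finite_bounded_exponents)
  show "minimal_exponents (newton_exponents v q c) \<subseteq> {b. \<forall>i. real (Poly_Mapping.lookup b i) \<le> R}"
  proof (intro subsetI CollectI allI, rule ccontr)
    fix b i
    assume b: "b \<in> minimal_exponents (newton_exponents v q c)" and big: "\<not> real (Poly_Mapping.lookup b i) \<le> R"
    have bN: "b \<in> newton_exponents v q c" using b by (simp add: minimal_exponents_def)
    obtain y where y: "\<forall>j\<in>{1..q}. 0 \<le> y j" "c \<le> (\<Sum>j\<in>{1..q}. y j)"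
      "(\<Sum>j\<in>{1..q}. y j *\<^sub>R real_vec (v j)) \<le> real_vec b" using newton_exponentsE[OF bN] .
    define s where "s = (\<Sum>j\<in>{1..q}. y j)"
    have "0 \<le> s" unfolding s_def using y(1) by (intro sum_nonneg) auto
    define t where "t = c / s"
    (* If s = 0 then c = 0, and the default value t = 0 of the quotient is the right factor. *)
    have t: "0 \<le> t" "t \<le> 1" "t * s = c"
      using \<open>0 \<le> c\<close> \<open>0 \<le> s\<close> y(2)[folded s_def] by (auto simp: t_def divide_le_eq_1)
    define y' where "y' j = t * y j" for j
    have y'0: "0 \<le> y' j" if "j \<in> {1..q}" for j using bspec[OF y(1) that] t(1) by (simp add: y'_def)
    have sum: "(\<Sum>j\<in>{1..q}. y' j) = c"
      using t(3) by (simp add: y'_def s_def flip: sum_distrib_left)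
    let ?z = "\<Sum>j\<in>{1..q}. y' j *\<^sub>R real_vec (v j)"
    have "?z \<le> (\<Sum>j\<in>{1..q}. y j *\<^sub>R real_vec (v j))"
    proof (intro sum_mono scaleR_right_mono)
      fix j assume "j \<in> {1..q}"
      then show "y' j \<le> y j" using mult_right_mono[OF t(2) bspec[OF y(1)]] by (simp add: y'_def)
    qed simp
    then have zb: "?z \<le> real_vec b" using y(3) by (rule order_trans)
    have zi: "?z $ i \<le> R - 1"
    proof -
      have "?z $ i \<le> (\<Sum>j\<in>{1..q}. c * real (Poly_Mapping.lookup (v j) i))"
        unfolding sum_component vector_scaleR_component real_vec_nth real_scaleR_def
      proof (intro sum_mono mult_right_mono)
        fix j assume "j \<in> {1..q}"
        then show "y' j \<le> c" using member_le_sum[of j "{1..q}" y'] y'0 sum by auto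
      qed simp
      also have "\<dots> \<le> R - 1"
        unfolding R_def using \<open>0 \<le> c\<close>
        by (simp, intro member_le_sum[of i UNIV "\<lambda>i. \<Sum>j\<in>_. c * real (Poly_Mapping.lookup (v j) i)"] sum_nonneg) auto
      finally show ?thesis .
    qed
    have "0 \<le> ?z $ i" using y'0 by (auto intro!: sum_nonneg)
    then have i: "1 \<le> Poly_Mapping.lookup b i" using zi big by simp
    define b' where "b' = b - Poly_Mapping.single i 1"
    have bb': "b = b' + Poly_Mapping.single i 1"
      using i by (intro poly_mapping_eqI) (auto simp: b'_def lookup_add lookup_minus lookup_single when_def)
    have "?z \<le> real_vec b'"
      unfolding less_eq_vec_def
    proof
      fix l
      show "?z $ l \<le> real_vec b' $ l"
      proof (cases "l = i")
        case True
        have "?z $ i \<le> real_vec b' $ i"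
          using zi big i by (simp add: b'_def lookup_minus of_nat_diff)
        with True show ?thesis by simp
      next
        case False
        then have "real_vec b' $ l = real_vec b $ l"
          by (simp add: b'_def lookup_minus lookup_single when_def)
        with zb show ?thesis by (simp add: less_eq_vec_def)
      qed
    qed
    then have "b' \<in> newton_exponents v q c"
      using y'0 sum by (intro newton_exponentsI[of q y']) auto
    then show False
      using b bb' minimal_exponents_iff_decrement[OF up_closed_newton_exponents] by blast
  qed
qed

section \<open>The integral closure of a power of a monomial ideal\<close>

text \<open>
  The module on which \<open>f\<close> acts is generated by the monomials of the finitely many minimal exponents of
  \<open>newton_exponents v q q\<close>. For an exponent \<open>a\<close> of \<open>f\<close> and a generator \<open>b\<close>, the sum \<open>a + b\<close> splits into an
  exponent \<open>E a b\<close> of the ideal power and another generator \<open>S a b\<close>; collecting the terms with the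
  same \<open>S a b\<close> gives the matrix of \<open>f\<close>. An element annihilating a monomial is zero.
\<close>

lemma monomial_span_newton_subset_integral_closure:
  fixes v :: "nat \<Rightarrow> 's::finite exponent"
  assumes "1 \<le> n" and U: "up_closed U" "U = {v j + c | j c. j \<in> {1..q}}"
  shows "monomial_span (newton_exponents v q n)
    \<subseteq> (integral_closure (ideal_power (monomial_span U) n) :: ('s, 'k::field) polyring set)"
proof
  fix f :: "('s, 'k) polyring"
  assume f: "f \<in> monomial_span (newton_exponents v q n)"
  let ?F = "sumset_power U n" and ?K = "Poly_Mapping.keys f"
  define J :: "('s, 'k) polyring set" where "J = ideal_power (monomial_span U) n"
  have J: "J = monomial_span ?F" unfolding J_def by (rule ideal_power_monomial_span[OF U(1)])
  show "f \<in> integral_closure (ideal_power (monomial_span U) n)"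
  proof (cases "f = 0")
    case True
    then show ?thesis
      unfolding integral_closure_def
      by (intro CollectI exI[of _ 1] conjI exI[of _ "\<lambda>_. 0"])
        (auto simp: ring.subspace_0[OF subspace_ideal_power] simp del: ideal_power.simps)
  next
    case False
    then obtain a0 where "a0 \<in> ?K" by fastforce
    with f have "a0 \<in> newton_exponents v q n" by (auto simp: monomial_span_def)
    with \<open>1 \<le> n\<close> have "1 \<le> q" by (cases q) (auto elim!: newton_exponentsE)
    define B where "B = minimal_exponents (newton_exponents v q (real q))"
    have "finite B" unfolding B_def by (rule finite_minimal_newton_exponents) simp
    have "(\<Sum>j\<in>{1..q}. v j) \<in> newton_exponents v q (real q)"
    proof (rule newton_exponentsI[where y = "\<lambda>_. 1"])
      show "(\<Sum>j\<in>{1..q}. 1 *\<^sub>R real_vec (v j)) \<le> real_vec (\<Sum>j\<in>{1..q}. v j)"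
        by (simp add: less_eq_vec_def lookup_sum)
    qed auto
    from above_minimal_exponent[OF this] obtain b0 where "b0 \<in> B" unfolding B_def by blast
    have "\<exists>e d. e \<in> ?F \<and> d \<in> B \<and> a + b = e + d" if "a \<in> ?K" "b \<in> B" for a b
    proof -
      have "a \<in> newton_exponents v q n" using that(1) f by (auto simp: monomial_span_def)
      moreover have "b \<in> newton_exponents v q q" using that(2) by (simp add: B_def minimal_exponents_def)
      ultimately have "a + b \<in> newton_exponents v q (real n + real q)" by (rule newton_exponents_add)
      from newton_exponents_split_power[OF \<open>1 \<le> q\<close> U(2) this]
      obtain e d where ed: "e \<in> ?F" "d \<in> newton_exponents v q q" "a + b = e + d" by blast
      obtain d' c where d: "d' \<in> B" "d = d' + c" using above_minimal_exponent[OF ed(2)] by (auto simp: B_def)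
      have "e + c \<in> ?F" using up_closed_sumset_power[OF U(1)] ed(1) by (simp add: up_closed_def)
      moreover have "a + b = (e + c) + d'" by (simp add: ed(3) d(2) ac_simps)
      ultimately show ?thesis using d(1) by blast
    qed
    then obtain E S where E: "\<And>a b. a \<in> ?K \<Longrightarrow> b \<in> B \<Longrightarrow> E a b \<in> ?F"
      and S: "\<And>a b. a \<in> ?K \<Longrightarrow> b \<in> B \<Longrightarrow> S a b \<in> B"
      and ES: "\<And>a b. a \<in> ?K \<Longrightarrow> b \<in> B \<Longrightarrow> a + b = E a b + S a b" by metis
    define t where "t a b = Poly_Mapping.single 0 (Poly_Mapping.lookup f a) * (monomial (E a b) :: ('s, 'k) polyring)" for a b
    define A where "A i j = (\<Sum>a\<in>?K. if S a i = j then t a i else 0)" for i j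
    have subJ: "ring.subspace J"
      unfolding J by (rule subspace_monomial_span[OF up_closed_sumset_power[OF U(1)]])
    have "t a b \<in> J" if "a \<in> ?K" "b \<in> B" for a b
      unfolding t_def using E[OF that] by (intro ring.subspace_scale[OF subJ]) (simp add: J)
    then have AJ: "A i j \<in> J" if "i \<in> B" for i j
      unfolding A_def using that by (intro ring.subspace_sum[OF subJ]) (auto simp: ring.subspace_0[OF subJ])
    have eq: "f * monomial i = (\<Sum>j\<in>B. A i j * monomial j)" if i: "i \<in> B" for i
    proof -
      have "f * monomial i = (\<Sum>a\<in>?K. Poly_Mapping.single 0 (Poly_Mapping.lookup f a) * monomial a) * monomial i"
        by (simp flip: polynomial_expansion)
      also have "\<dots> = (\<Sum>a\<in>?K. t a i * monomial (S a i))"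
        unfolding sum_distrib_right t_def
        using ES i by (intro sum.cong refl) (simp add: mult.assoc flip: monomial_add)
      also have "\<dots> = (\<Sum>a\<in>?K. \<Sum>j\<in>B. if S a i = j then t a i * monomial j else 0)"
        using S i \<open>finite B\<close> by (intro sum.cong refl) simp
      also have "\<dots> = (\<Sum>j\<in>B. A i j * monomial j)"
        unfolding A_def sum_distrib_right
        by (subst sum.swap) (intro sum.cong refl, simp)
      finally show ?thesis .
    qed
    obtain k r where k: "1 \<le> k" and r: "\<forall>i\<in>{1..k}. r i \<in> ideal_power J i"
      and zero: "(f ^ k + (\<Sum>i\<in>{1..k}. r i * f ^ (k - i))) * monomial b0 = 0"
      using integral_equation_annihilates[of B b0 A J f monomial, OF \<open>finite B\<close> \<open>b0 \<in> B\<close> AJ eq] by blast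
    from mult_monomial_eq_0[OF zero] k r show ?thesis
      unfolding integral_closure_def J_def[symmetric] by blast
  qed
qed

text \<open>
  Both programs share an optimal value, and since the maximum is attained it is the largest \<open>c\<close> with
  \<open>a \<in> newton_exponents v q c\<close>. All uses of linear programming go through this statement.
\<close>

lemma lp_duality_newton_exponents:
  fixes v :: "nat \<Rightarrow> 's::finite exponent"
  assumes "\<forall>j\<in>{1..q}. v j \<noteq> 0"
  shows "\<exists>m. is_max m (primal_values q (incidence_matrix v) (real_vec a)) \<and>
    is_min m (dual_values q (incidence_matrix v) (real_vec a)) \<and>
    (\<forall>c. a \<in> newton_exponents v q c \<longleftrightarrow> c \<le> m)"
proof -
  let ?P = "primal_values q (incidence_matrix v) (real_vec a)"
  have "\<forall>j\<in>{1..q}. 0 \<le> incidence_matrix v j" "\<forall>j\<in>{1..q}. incidence_matrix v j \<noteq> 0"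
    using assms by (auto simp: incidence_matrix_def real_vec_eq_0_iff)
  from strong_duality[OF this real_vec_nonneg]
  obtain m where m: "is_max m ?P" "is_min m (dual_values q (incidence_matrix v) (real_vec a))" by blast
  have "a \<in> newton_exponents v q c \<longleftrightarrow> (\<exists>t\<in>?P. c \<le> t)" for c
    unfolding newton_exponents_def primal_values_def incidence_matrix_def by fastforce
  then have "a \<in> newton_exponents v q c \<longleftrightarrow> c \<le> m" for c
    using m(1) unfolding is_max_def by (meson order_trans)
  with m show ?thesis by blast
qed

text \<open>
  The remaining inclusion evaluates the weight given by an optimal dual solution: it is at least \<open>1\<close> on
  the exponents of \<open>I\<close>, hence at least \<open>n\<close> on those of \<open>I\<^sup>n\<close> and of its integral closure.
\<close>

lemma integral_closure_power_monomial_ideal: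
  fixes v :: "nat \<Rightarrow> 's::finite exponent"
  assumes "1 \<le> n" and v: "\<forall>j\<in>{1..q}. v j \<noteq> 0"
    and U: "up_closed U" "U = {v j + c | j c. j \<in> {1..q}}"
  shows "integral_closure (ideal_power (monomial_span U) n) =
    (monomial_span (newton_exponents v q n) :: ('s, 'k::field) polyring set)"
proof (rule equalityI[OF _ monomial_span_newton_subset_integral_closure[OF assms(1) U]])
  show "integral_closure (ideal_power (monomial_span U) n) \<subseteq>
      (monomial_span (newton_exponents v q n) :: ('s, 'k) polyring set)"
    unfolding monomial_span_def[of "newton_exponents v q n"]
  proof (intro subsetI CollectI, rule ccontr)
    fix f :: "('s, 'k) polyring" and a
    assume f: "f \<in> integral_closure (ideal_power (monomial_span U) n)"
      and a: "a \<in> Poly_Mapping.keys f" and "a \<notin> newton_exponents v q n"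
    then obtain m where m: "is_min m (dual_values q (incidence_matrix v) (real_vec a))" "m < n"
      using lp_duality_newton_exponents[OF v, of a] by (metis not_le)
    then obtain x where x: "m = real_vec a \<bullet> x" "0 \<le> x" "\<forall>j\<in>{1..q}. 1 \<le> x \<bullet> real_vec (v j)"
      by (auto simp: is_min_def dual_values_def incidence_matrix_def)
    define w where "w b = x \<bullet> real_vec b" for b
    have w_add: "w (b + d) = w b + w d" for b d
      by (simp add: w_def real_vec_add inner_add_right)
    have w_nonneg: "0 \<le> w b" for b
      using x(2) by (auto simp: w_def inner_vec_def less_eq_vec_def intro!: sum_nonneg)
    have w_U: "1 \<le> w b" if b: "b \<in> U" for b
    proof -
      obtain j c where "b = v j + c" "j \<in> {1..q}" using b unfolding U(2) by blast
      then show ?thesis using x(3) w_nonneg[of c] by (simp add: w_add) (simp add: w_def add_increasing2)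
    qed
    have w_power: "real k \<le> w b" if "b \<in> sumset_power U k" for b k
      using that
    proof (induction k arbitrary: b)
      case 0
      then show ?case by (simp add: w_nonneg)
    next
      case (Suc k)
      then obtain b1 b2 where b: "b = b1 + b2" "b1 \<in> U" "b2 \<in> sumset_power U k" by auto
      show ?case using Suc.IH[OF b(3)] w_U[OF b(2)] by (simp add: b(1) w_add)
    qed
    have "real n \<le> w a"
      using weight_of_integral_element[OF up_closed_sumset_power[OF U(1)] w_add w_power _ a] f
      by (simp add: ideal_power_monomial_span[OF U(1)])
    with m(2) x(1) show False by (simp add: w_def inner_commute)
  qed
qed

theorem proposition3p4:
  fixes I :: "('s::finite, 'k::field) polyring set"
    and q n :: nat
    and v :: "nat \<Rightarrow> 's exponent"
    and A :: "nat \<Rightarrow> real ^ 's"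
    and \<alpha> :: "'s exponent"
  assumes "n \<ge> 1"
    and "monomial_ideal I"
    and "bij_betw (\<lambda>j. monomial (v j)) {1..q} (minimal_gens I)"
    and "\<forall>j\<in>{1..q}. v j \<noteq> 0"
    and "A = incidence_matrix v"
  shows "(monomial \<alpha> :: ('s, 'k) polyring) \<in> minimal_gens (integral_closure (ideal_power I n)) \<longleftrightarrow>
    (\<exists>m. is_max m (primal_values q A (real_vec \<alpha>)) \<and>
         is_min m (dual_values q A (real_vec \<alpha>)) \<and> m \<ge> real n) \<and>
    (\<forall>i. real_vec \<alpha> - axis i 1 \<ge> 0 \<longrightarrow>
      (\<exists>m. is_max m (primal_values q A (real_vec \<alpha> - axis i 1)) \<and>
           is_min m (dual_values q A (real_vec \<alpha> - axis i 1)) \<and> m < real n))"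
proof -
  obtain U where U: "up_closed U" "I = monomial_span U"
    using assms(2) by (auto simp: monomial_ideal_iff)
  let ?N = "newton_exponents v q n"
  have "(\<lambda>j. monomial (v j)) ` {1..q} = (monomial ` minimal_exponents U :: ('s, 'k) polyring set)"
    using assms(3) by (simp add: U minimal_gens_monomial_span bij_betw_def)
  then have "monomial ` (v ` {1..q}) = (monomial ` minimal_exponents U :: ('s, 'k) polyring set)"
    by (simp add: image_image)
  then have "v ` {1..q} = minimal_exponents U"
    by (rule inj_image_eq_iff[THEN iffD1, rotated]) (simp add: inj_def)
  then have "U = {e + c | e c. e \<in> v ` {1..q}}"
    using minimal_exponents_generate[OF U(1)] by simp
  then have Uv: "U = {v j + c | j c. j \<in> {1..q}}" by blast
  have unique: "m = m'" if "is_max m X" "is_max m' X" for m m' X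
    using that by (auto simp: is_max_def intro: order_antisym)
  have in_N: "b \<in> ?N \<longleftrightarrow> (\<exists>m. is_max m (primal_values q A (real_vec b)) \<and>
      is_min m (dual_values q A (real_vec b)) \<and> m \<ge> real n)"
    and notin_N: "b \<notin> ?N \<longleftrightarrow> (\<exists>m. is_max m (primal_values q A (real_vec b)) \<and>
      is_min m (dual_values q A (real_vec b)) \<and> m < real n)" for b
    using lp_duality_newton_exponents[OF assms(4), of b] unique assms(5) by (metis not_le)+
  have "(monomial \<alpha> :: ('s, 'k) polyring) \<in> minimal_gens (integral_closure (ideal_power I n)) \<longleftrightarrow>
      \<alpha> \<in> minimal_exponents ?N"
    unfolding U(2) integral_closure_power_monomial_ideal[OF assms(1,4) U(1) Uv]
      minimal_gens_monomial_span[OF up_closed_newton_exponents] by auto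
  also have "\<dots> \<longleftrightarrow> \<alpha> \<in> ?N \<and> (\<forall>i b. \<alpha> = b + Poly_Mapping.single i 1 \<longrightarrow> b \<notin> ?N)"
    by (rule minimal_exponents_iff_decrement[OF up_closed_newton_exponents])
  also have "(\<forall>i b. \<alpha> = b + Poly_Mapping.single i 1 \<longrightarrow> b \<notin> ?N) \<longleftrightarrow>
    (\<forall>i. real_vec \<alpha> - axis i 1 \<ge> 0 \<longrightarrow>
      (\<exists>m. is_max m (primal_values q A (real_vec \<alpha> - axis i 1)) \<and>
           is_min m (dual_values q A (real_vec \<alpha> - axis i 1)) \<and> m < real n))"
    (is "?l \<longleftrightarrow> ?r")
  proof
    assume l: ?l
    show ?r
    proof (intro allI impI)
      fix i assume "real_vec \<alpha> - axis i 1 \<ge> 0"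
      then have "0 \<le> (real_vec \<alpha> - axis i 1) $ i" by (simp only: less_eq_vec_def zero_index)
      then have "1 \<le> Poly_Mapping.lookup \<alpha> i" by simp
      then have \<alpha>: "\<alpha> = (\<alpha> - Poly_Mapping.single i 1) + Poly_Mapping.single i 1"
        by (intro poly_mapping_eqI) (auto simp: lookup_add lookup_minus lookup_single when_def)
      then have "real_vec \<alpha> - axis i 1 = real_vec (\<alpha> - Poly_Mapping.single i 1)"
        by (metis real_vec_add real_vec_single add_diff_cancel_right')
      moreover have "\<alpha> - Poly_Mapping.single i 1 \<notin> ?N" using l \<alpha> by blast
      ultimately show "\<exists>m. is_max m (primal_values q A (real_vec \<alpha> - axis i 1)) \<and>
           is_min m (dual_values q A (real_vec \<alpha> - axis i 1)) \<and> m < real n"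
        using notin_N by simp
    qed
  next
    assume r: ?r
    show ?l
    proof (intro allI impI)
      fix i b assume "\<alpha> = b + Poly_Mapping.single i 1"
      then have "real_vec \<alpha> - axis i 1 = real_vec b"
        by (simp only: real_vec_add real_vec_single add_diff_cancel_right')
      with r[rule_format, of i] show "b \<notin> ?N" using notin_N[of b] by simp
    qed
  qed
  finally show ?thesis by (simp only: in_N)
qed

end
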